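(* Let $\mu$ be the law of the $\mathsf{sine}_2$ point process on the configuration space $\boldsymbol\Upsilon$ over $\mathbb{R}$, and let $(\mathcal{E}, \mathcal{F}C_b^\infty(\mathcal{D}))$ be the pre-Dirichlet form $\mathcal{E}(U,V)=\frac12\int_{\boldsymbol\Upsilon}\Gamma^{\boldsymbol\Upsilon}(U,V)\,d\mu$ on the space $\mathcal{F}C_b^\infty(\mathcal{D})$ of cylinder functions (all defined in the context). Then every closed extension $(\mathcal{E},\mathcal{F})$ of $(\mathcal{E}, \mathcal{F}C_b^\infty(\mathcal{D}))$ on $L^2(\boldsymbol\Upsilon,\mu)$ fails to have a spectral gap, i.e. $$\inf_{\substack{u\in\mathcal{F}\\ \mathrm{Var}(u)\neq 0}}\frac{\mathcal{E}(u)}{\mathrm{Var}(u)}=0,$$ where $\mathcal{E}(u):=\mathcal{E}(u,u)$ and $\mathrm{Var}(u):=\int_{\boldsymbol\Upsilon}u^2\,d\mu-\bigl(\int_{\boldsymbol\Upsilon}u\,d\mu\bigr)^2$.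
   Context: Configuration space: $\boldsymbol\Upsilon$ is the space of Radon point measures on $\mathbb{R}$ (locally finite configurations of points in $\mathbb{R}$). The measure $\mu$: $\mu$ is the law on $\boldsymbol\Upsilon$ of the $\mathsf{sine}_2$ point process, i.e. of the determinantal point process whose $n$-point correlation functions (with respect to Lebesgue measure) are $$\rho^{(n)}(x_1,\dots,x_n)=\det\bigl(K(x_i,x_j)\bigr)_{i,j=1}^n,\qquad K(x,y)=\frac{\sin\pi(x-y)}{\pi(x-y)},$$ with $K(x,x)=1$. $L^2(\boldsymbol\Upsilon,\mu)$ is the space of $\mu$-equivalence classes of square-integrable real-valued functions on $\boldsymbol\Upsilon$. Linear statistics: for $u:\mathbb{R}\to\mathbb{R}$, $u^*(\gamma):=\int_{\mathbb{R}}u\,d\gamma$ for $\gamma\in\boldsymbol\Upsilon$. Cylinder functions: $\mathcal{D}=C_c^\infty(\mathbb{R})$ is the space of real-valued compactly supported smooth functions on $\mathbb{R}$, and $C_b^\infty(\mathbb{R}^k)$ is the space of real-valued smooth functions on $\mathbb{R}^k$ all of whose derivatives of arbitrary order are continuous and bounded. $\mathcal{F}C_b^\infty(\mathcal{D})$ is the space of functions $U:\boldsymbol\Upsilon\to\mathbb{R}$ of the form $U=\Phi(u_1^*,\dots,u_k^* )$ with $k\in\mathbb{N}$, $u_1,\dots,u_k\in\mathcal{D}$, $\Phi\in C_b^\infty(\mathbb{R}^k)$. Square field: for $u,v:\mathbb{R}\to\mathbb{R}$, $\Gamma^{\mathbb{R}}(u,v):=u'v'$. For $U=\Phi(u_1^*,\dots,u_k^*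 )\in\mathcal{F}C_b^\infty(\mathcal{D})$, $$\Gamma^{\boldsymbol\Upsilon}(U):=\sum_{i,j=1}^k\partial_i\Phi(u_1^*,\dots,u_k^* )\,\partial_j\Phi(u_1^*,\dots,u_k^* )\,\Gamma^{\mathbb{R}}(u_i,u_j)^*,$$ and $\Gamma^{\boldsymbol\Upsilon}(U,V):=\frac14\bigl(\Gamma^{\boldsymbol\Upsilon}(U+V)-\Gamma^{\boldsymbol\Upsilon}(U-V)\bigr)$. The form: $\mathcal{E}(U,V):=\frac12\int_{\boldsymbol\Upsilon}\Gamma^{\boldsymbol\Upsilon}(U,V)\,d\mu$ for $U,V\in\mathcal{F}C_b^\infty(\mathcal{D})$. Closed extension: let $\mathcal{Q}$ be a symmetric bilinear form on $L^2(\boldsymbol\Upsilon,\mu)$ with dense domain $\mathcal{F}=\{u\in L^2(\boldsymbol\Upsilon,\mu):\mathcal{Q}(u,u)<\infty\}$ and $\mathcal{Q}(u,u)\ge 0$ for all $u\in\mathcal{F}$. It is closed if $\mathcal{F}$ with the norm given by $\|u\|_{\mathcal{F}}^2=\mathcal{Q}(u,u)+\|u\|_{L^2(\mu)}^2$ is a real Hilbert space. The pair $(\mathcal{Q},\mathcal{F})$ is a closed extension of $(\mathcal{E},\mathcal{F}C_b^\infty(\mathcal{D}))$ if it is closed, $\mathcal{F}C_b^\infty(\mathcal{D})\subset\mathcal{F}$, and $\mathcal{Q}=\mathcal{E}$ on $\mathcal{F}C_b^\infty(\mathcal{D})\times\mathcal{F}C_b^\infty(\mathcal{D})$. The extension is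 again denoted $(\mathcal{E},\mathcal{F})$. *)

theory Defs
  imports "HOL-Probability.Probability" "Jordan_Normal_Form.Determinant"
begin

section \<open>Configuration space\<close>

text \<open>
  Radon point measures: locally finite sums of Dirac masses, multiplicities allowed. The measure
  \<open>distr (count_space I) borel x\<close> is the sum of the Dirac masses at \<open>x i\<close> for \<open>i \<in> I\<close>.
\<close>
definition configurations :: "real measure set" where
  "configurations =
    {distr (count_space I) borel x | (I :: nat set) x.
       \<forall>K. compact K \<longrightarrow> finite {i \<in> I. x i \<in> K}}"

text \<open>
  The sigma-algebra generated by the evaluations \<open>\<gamma> \<mapsto> \<gamma>(B)\<close>, which is the Borel
  sigma-algebra of the vague topology. Only the space and the sigma-algebra of this object matter.
\<close>
definition configuration_algebra :: "real measure measure" where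
  "configuration_algebra =
    (SUP B \<in> sets borel. vimage_algebra configurations (\<lambda>\<gamma>. emeasure \<gamma> B) borel)"

definition lin_stat :: "(real \<Rightarrow> real) \<Rightarrow> real measure \<Rightarrow> real" where
  "lin_stat u \<gamma> = (\<integral>x. u x \<partial>\<gamma>)"


section \<open>The sine process\<close>

definition falling_factorial :: "real \<Rightarrow> nat \<Rightarrow> real" where
  "falling_factorial c k = (\<Prod>l<k. c - real l)"

text \<open>
  For disjoint bounded Borel sets \<open>A\<^sub>0, \<dots>, A\<^sub>m\<^sub>-\<^sub>1\<close> and multiplicities \<open>k\<^sub>0 + \<dots> + k\<^sub>m\<^sub>-\<^sub>1 = n\<close>, the
  expectation of the product of the falling factorials \<open>\<gamma>(A\<^sub>j) (\<gamma>(A\<^sub>j) - 1) \<dots> (\<gamma>(A\<^sub>j) - k\<^sub>j + 1)\<close>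
  is the integral of the \<open>n\<close>-point function over the product of the \<open>A\<^sub>j\<close>, each taken \<open>k\<^sub>j\<close> times.
  The map \<open>b\<close> assigns to each of the \<open>n\<close> coordinates its set, so \<open>k\<^sub>j\<close> is the size of a fibre.
  Repeated sets are needed to control multiple points.
\<close>
definition has_correlation_functions ::
    "real measure measure \<Rightarrow> (nat \<Rightarrow> (nat \<Rightarrow> real) \<Rightarrow> real) \<Rightarrow> bool" where
  "has_correlation_functions P \<rho> \<longleftrightarrow>
    (\<forall>n m (A :: nat \<Rightarrow> real set) b.
       (\<forall>j<m. A j \<in> sets borel \<and> bounded (A j)) \<longrightarrow>
       disjoint_family_on A {..<m} \<longrightarrow>
       b \<in> {..<n} \<rightarrow> {..<m} \<longrightarrow>
       set_integrable (PiM {..<n} (\<lambda>_. lborel)) (PiE {..<n} (\<lambda>i. A (b i))) (\<rho> n) \<and>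
       has_bochner_integral P
         (\<lambda>\<gamma>. \<Prod>j<m. falling_factorial (measure \<gamma> (A j)) (card {i \<in> {..<n}. b i = j}))
         (set_lebesgue_integral (PiM {..<n} (\<lambda>_. lborel)) (PiE {..<n} (\<lambda>i. A (b i))) (\<rho> n)))"

definition determinantal_process :: "real measure measure \<Rightarrow> (real \<Rightarrow> real \<Rightarrow> real) \<Rightarrow> bool" where
  "determinantal_process P K \<longleftrightarrow>
    prob_space P \<and> sets P = sets configuration_algebra \<and>
    has_correlation_functions P
      (\<lambda>n x. Determinant.det (Matrix.mat n n (\<lambda>(i, j). K (x i) (x j))))"

definition sine_kernel :: "real \<Rightarrow> real \<Rightarrow> real" where
  "sine_kernel x y = (if x = y then 1 else sin (pi * (x - y)) / (pi * (x - y)))"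

definition sine2_law :: "real measure measure \<Rightarrow> bool" where
  "sine2_law P \<longleftrightarrow> determinantal_process P sine_kernel"


section \<open>Cylinder functions\<close>

definition test_functions :: "(real \<Rightarrow> real) set" where
  "test_functions =
    {u. (\<forall>n x. (deriv ^^ n) u differentiable (at x)) \<and> compact (closure {x. u x \<noteq> 0})}"

text \<open>
  A function on \<open>\<real>\<^sup>k\<close> is encoded as a function on sequences that only depends on the coordinates
  with index below \<open>k\<close>. For such functions, continuity in the product topology on sequences is
  continuity on \<open>\<real>\<^sup>k\<close>.
\<close>
definition partial_deriv :: "nat \<Rightarrow> ((nat \<Rightarrow> real) \<Rightarrow> real) \<Rightarrow> (nat \<Rightarrow> real) \<Rightarrow> real" where
  "partial_deriv i \<Phi> x = deriv (\<lambda>t. \<Phi> (x(i := t))) (x i)"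

definition smooth_bounded :: "nat \<Rightarrow> ((nat \<Rightarrow> real) \<Rightarrow> real) set" where
  "smooth_bounded k =
    {\<Phi>. (\<forall>x y. (\<forall>i<k. x i = y i) \<longrightarrow> \<Phi> x = \<Phi> y) \<and>
        (\<forall>is. set is \<subseteq> {..<k} \<longrightarrow>
           (let \<Psi> = foldr partial_deriv is \<Phi> in
              continuous_on UNIV \<Psi> \<and> bounded (range \<Psi>) \<and>
              (\<forall>i<k. \<forall>x. (\<lambda>t. \<Psi> (x(i := t))) differentiable (at (x i)))))}"

text \<open>Values outside \<^const>\<open>configurations\<close> are irrelevant throughout.\<close>
definition cylinder_rep ::
    "nat \<Rightarrow> ((nat \<Rightarrow> real) \<Rightarrow> real) \<Rightarrow> (nat \<Rightarrow> real \<Rightarrow> real) \<Rightarrow> (real measure \<Rightarrow> real) \<Rightarrow> bool" where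
  "cylinder_rep k \<Phi> u U \<longleftrightarrow>
    \<Phi> \<in> smooth_bounded k \<and> (\<forall>i<k. u i \<in> test_functions) \<and>
    (\<forall>\<gamma>\<in>configurations. U \<gamma> = \<Phi> (\<lambda>i. lin_stat (u i) \<gamma>))"

definition cylinder_functions :: "(real measure \<Rightarrow> real) set" where
  "cylinder_functions = {U. \<exists>k \<Phi> u. cylinder_rep k \<Phi> u U}"


section \<open>Square field and energy\<close>

definition square_field_R :: "(real \<Rightarrow> real) \<Rightarrow> (real \<Rightarrow> real) \<Rightarrow> real \<Rightarrow> real" where
  "square_field_R u v x = deriv u x * deriv v x"

text \<open>
  The description is proper: moving one atom \<open>x\<close> of \<open>\<gamma>\<close> shows that \<open>U\<close> determines the sum over
  \<open>i\<close> of \<open>\<partial>\<^sub>i\<Phi> (u\<^sub>0\<^sup>*, \<dots>) u\<^sub>i'(x)\<close>, and the expression below is the \<open>\<gamma>\<close>-integral over \<open>x\<close> of its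
  square. So it does not depend on the chosen representation of \<open>U\<close>.
\<close>
definition square_field :: "(real measure \<Rightarrow> real) \<Rightarrow> real measure \<Rightarrow> real" where
  "square_field U \<gamma> =
    (THE r. \<exists>k \<Phi> u. cylinder_rep k \<Phi> u U \<and>
       r = (\<Sum>i<k. \<Sum>j<k.
              partial_deriv i \<Phi> (\<lambda>l. lin_stat (u l) \<gamma>) *
              partial_deriv j \<Phi> (\<lambda>l. lin_stat (u l) \<gamma>) *
              lin_stat (square_field_R (u i) (u j)) \<gamma>))"

definition square_field2 ::
    "(real measure \<Rightarrow> real) \<Rightarrow> (real measure \<Rightarrow> real) \<Rightarrow> real measure \<Rightarrow> real" where
  "square_field2 U V \<gamma> =
    (square_field (\<lambda>\<eta>. U \<eta> + V \<eta>) \<gamma> - square_field (\<lambda>\<eta>. U \<eta> - V \<eta>) \<gamma>) / 4"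

definition energy ::
    "real measure measure \<Rightarrow> (real measure \<Rightarrow> real) \<Rightarrow> (real measure \<Rightarrow> real) \<Rightarrow> real" where
  "energy P U V = (\<integral>\<gamma>. square_field2 U V \<gamma> \<partial>P) / 2"


section \<open>Closed forms\<close>

text \<open>
  Elements of \<open>L\<^sup>2\<close> are handled through representatives: domains of forms are saturated under almost
  everywhere equality and forms do not see the choice of representative.
\<close>
definition L2 :: "'a measure \<Rightarrow> ('a \<Rightarrow> real) set" where
  "L2 M = {f \<in> borel_measurable M. integrable M (\<lambda>x. (f x)\<^sup>2)}"

definition L2_sqnorm :: "'a measure \<Rightarrow> ('a \<Rightarrow> real) \<Rightarrow> real" where
  "L2_sqnorm M f = (\<integral>x. (f x)\<^sup>2 \<partial>M)"

definition L2_subspace :: "'a measure \<Rightarrow> ('a \<Rightarrow> real) set \<Rightarrow> bool" where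
  "L2_subspace M F \<longleftrightarrow>
    F \<subseteq> L2 M \<and>
    (\<forall>f\<in>F. \<forall>g\<in>borel_measurable M. (AE x in M. f x = g x) \<longrightarrow> g \<in> F) \<and>
    (\<lambda>_. 0) \<in> F \<and>
    (\<forall>f\<in>F. \<forall>g\<in>F. (\<lambda>x. f x + g x) \<in> F) \<and>
    (\<forall>c. \<forall>f\<in>F. (\<lambda>x. c * f x) \<in> F)"

definition L2_dense :: "'a measure \<Rightarrow> ('a \<Rightarrow> real) set \<Rightarrow> bool" where
  "L2_dense M F \<longleftrightarrow> (\<forall>f\<in>L2 M. \<forall>e>0. \<exists>g\<in>F. sqrt (L2_sqnorm M (\<lambda>x. f x - g x)) < e)"

definition nonneg_symmetric_form ::
    "'a measure \<Rightarrow> (('a \<Rightarrow> real) \<Rightarrow> ('a \<Rightarrow> real) \<Rightarrow> real) \<Rightarrow> ('a \<Rightarrow> real) set \<Rightarrow> bool" where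
  "nonneg_symmetric_form M Q F \<longleftrightarrow>
    L2_subspace M F \<and> L2_dense M F \<and>
    (\<forall>f\<in>F. \<forall>g\<in>F. \<forall>h\<in>F. (AE x in M. f x = g x) \<longrightarrow> Q f h = Q g h) \<and>
    (\<forall>f\<in>F. \<forall>g\<in>F. Q f g = Q g f) \<and>
    (\<forall>f\<in>F. \<forall>g\<in>F. \<forall>h\<in>F. Q (\<lambda>x. f x + g x) h = Q f h + Q g h) \<and>
    (\<forall>c. \<forall>f\<in>F. \<forall>h\<in>F. Q (\<lambda>x. c * f x) h = c * Q f h) \<and>
    (\<forall>f\<in>F. Q f f \<ge> 0)"

definition form_norm ::
    "'a measure \<Rightarrow> (('a \<Rightarrow> real) \<Rightarrow> ('a \<Rightarrow> real) \<Rightarrow> real) \<Rightarrow> ('a \<Rightarrow> real) \<Rightarrow> real" where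
  "form_norm M Q f = sqrt (Q f f + L2_sqnorm M f)"

text \<open>
  The norm comes from the inner product \<open>Q(f, g) + \<langle>f, g\<rangle>\<close>, which is definite modulo almost everywhere
  equality, so being a Hilbert space amounts to completeness.
\<close>
definition closed_form ::
    "'a measure \<Rightarrow> (('a \<Rightarrow> real) \<Rightarrow> ('a \<Rightarrow> real) \<Rightarrow> real) \<Rightarrow> ('a \<Rightarrow> real) set \<Rightarrow> bool" where
  "closed_form M Q F \<longleftrightarrow>
    nonneg_symmetric_form M Q F \<and>
    (\<forall>X :: nat \<Rightarrow> 'a \<Rightarrow> real.
       (\<forall>n. X n \<in> F) \<longrightarrow>
       (\<forall>e>0. \<exists>N. \<forall>m\<ge>N. \<forall>n\<ge>N. form_norm M Q (\<lambda>x. X m x - X n x) < e) \<longrightarrow>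
       (\<exists>f\<in>F. (\<lambda>n. form_norm M Q (\<lambda>x. X n x - f x)) \<longlonglongrightarrow> 0))"

definition closed_extension ::
    "real measure measure \<Rightarrow>
     ((real measure \<Rightarrow> real) \<Rightarrow> (real measure \<Rightarrow> real) \<Rightarrow> real) \<Rightarrow>
     (real measure \<Rightarrow> real) set \<Rightarrow> bool" where
  "closed_extension P Q F \<longleftrightarrow>
    closed_form P Q F \<and> cylinder_functions \<subseteq> F \<and>
    (\<forall>U\<in>cylinder_functions. \<forall>V\<in>cylinder_functions. Q U V = energy P U V)"

definition Var :: "'a measure \<Rightarrow> ('a \<Rightarrow> real) \<Rightarrow> real" where
  "Var M u = (\<integral>x. (u x)\<^sup>2 \<partial>M) - (\<integral>x. u x \<partial>M)\<^sup>2"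

end

theory Submission
  imports Defs
begin

text \<open>
  Stretching a fixed profile \<open>u\<close> to \<open>u\<^sub>r(x) = u(x/2r)\<close> makes the energy of its linear statistic
  \<open>u\<^sub>r\<^sup>*\<close> decay: the square field of \<open>u\<^sub>r\<^sup>*\<close> is the linear statistic of \<open>(u\<^sub>r')\<^sup>2\<close>, which is of size
  \<open>r\<^sup>-\<^sup>2\<close> on a window of length of order \<open>r\<close>, so the energy is \<open>O(1/r)\<close>. The variance of \<open>u\<^sub>r\<^sup>*\<close>, on the
  other hand, stays bounded away from zero, because the squared kernel of the sine process decays only
  like \<open>(x - y)\<^sup>-\<^sup>2\<close>, which is scale invariant in dimension one. Hence the quotient tends to zero.

  Since \<open>u\<^sub>r\<^sup>*\<close> itself is unbounded, it is replaced by the cylinder function \<open>L sin(u\<^sub>r\<^sup>*/L)\<close>. Its energy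
  is at most that of \<open>u\<^sub>r\<^sup>*\<close> (\<open>energy_sine_stat_le\<close>), and its variance converges to that of \<open>u\<^sub>r\<^sup>*\<close> as
  \<open>L \<rightarrow> \<infinity>\<close> (\<open>Var_sine_stat_tendsto\<close>). To evaluate the energy, the square field has to be shown
  independent of the representation of a cylinder function (\<open>gradient_sq_unique\<close>): the derivative of
  the function under motion of one atom depends on the function alone, and the square field is the
  sum of the squares of these derivatives over all atoms.

  The lower bound for the variance (\<open>lin_stat_variance_lower_bound\<close>) rests on the covariances of the
  numbers of points in small cells. Distinct cells are negatively correlated, with covariance
  \<open>- \<integral>\<integral> K(x,y)\<^sup>2\<close> over the two cells. The rows of the covariance matrix have nonnegative sums
  (\<open>count_cov_row_nonneg\<close>); in the limit this says \<open>\<integral> K(x,y)\<^sup>2 dy \<le> 1\<close>, but it follows without computing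
  that integral: the covariance matrix is a Toeplitz matrix and the variance of the number of points
  in a long interval is nonnegative. For a matrix \<open>C\<close> with these two properties,
  \<open>\<Sum> c\<^sub>j c\<^sub>k C\<^sub>j\<^sub>k\<close> is bounded below by \<open>\<Sum> (c\<^sub>j - c\<^sub>k)\<^sup>2 (- C\<^sub>j\<^sub>k) / 2\<close> (\<open>quadratic_form_lower_bound\<close>), and the
  pairs of cells in \<open>[-r,r) \<times> [2r,4r)\<close>, where the profile is large and zero respectively, contribute a
  constant independent of \<open>r\<close> (\<open>pair_integral_lower_bound\<close>).
\<close>

section \<open>A smooth bump function\<close>

text \<open>
  The bump function is \<open>exp(-1/(1-x\<^sup>2))\<close>. The larger family with a factor \<open>p(x)/(1-x\<^sup>2)\<^sup>n\<close> is closed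
  under differentiation, which gives smoothness by induction.
\<close>
definition bump_term :: "real poly \<Rightarrow> nat \<Rightarrow> real \<Rightarrow> real" where
  "bump_term p n x =
    (if \<bar>x\<bar> < 1 then poly p x / (1 - x\<^sup>2) ^ n * exp (- (1 / (1 - x\<^sup>2))) else 0)"

lemma abs_less_one_sq: "\<bar>x::real\<bar> < 1 \<longleftrightarrow> 0 < 1 - x\<^sup>2"
  using abs_square_less_1[of x] by auto

text \<open>
  The term of order \<open>n + 2\<close> of the exponential series at \<open>1/y\<close>. Two powers of \<open>y\<close> are left over, so
  that the members of the family vanish to second order at the points \<open>1\<close> and \<open>-1\<close>.
\<close>
lemma power_div_exp_bound:
  fixes y :: real
  assumes "0 < y"
  shows "exp (- (1 / y)) / y ^ n \<le> fact (n + 2) * y\<^sup>2"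
proof -
  have "(1 / y) ^ (n + 2) / fact (n + 2) = (1 / y) ^ (n + 2) /\<^sub>R fact (n + 2)"
    by (simp add: divide_inverse mult.commute)
  also have "\<dots> \<le> (\<Sum>k. (1 / y) ^ k /\<^sub>R fact k)"
    using sum_le_suminf[OF summable_exp_generic[of "1 / y"], of "{n + 2}"] assms by simp
  also have "\<dots> = exp (1 / y)"
    by (simp add: exp_def)
  finally have "1 / y ^ (n + 2) \<le> fact (n + 2) * exp (1 / y)"
    by (subst (asm) pos_divide_le_eq) (auto simp: power_one_over mult.commute)
  hence "y ^ 2 * (1 / y ^ (n + 2)) * exp (- (1 / y)) \<le> y ^ 2 * (fact (n + 2) * exp (1 / y)) * exp (- (1 / y))"
    using assms by (intro mult_right_mono mult_left_mono) auto
  also have "\<dots> = fact (n + 2) * y ^ 2"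
    by (simp add: exp_minus)
  also have "y ^ 2 * (1 / y ^ (n + 2)) = 1 / y ^ n"
    using assms by (simp add: power_add power2_eq_square)
  finally show ?thesis
    by simp
qed

lemma bump_term_bound:
  obtains B where "0 \<le> B" "\<And>x. \<bar>bump_term p n x\<bar> \<le> B * (1 - x\<^sup>2)\<^sup>2"
proof -
  have "bounded (poly p ` {-1..1})"
    by (intro compact_imp_bounded compact_continuous_image continuous_intros) auto
  then obtain B where B: "0 < B" "\<And>x. x \<in> {-1..1} \<Longrightarrow> \<bar>poly p x\<bar> \<le> B"
    by (auto simp: bounded_pos)
  show thesis
  proof (rule that[of "B * fact (n + 2)"])
    fix x :: real
    show "\<bar>bump_term p n x\<bar> \<le> B * fact (n + 2) * (1 - x\<^sup>2)\<^sup>2"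
    proof (cases "\<bar>x\<bar> < 1")
      case True
      hence y: "0 < 1 - x\<^sup>2"
        by (simp add: abs_less_one_sq)
      have "\<bar>bump_term p n x\<bar> = \<bar>poly p x\<bar> * (exp (- (1 / (1 - x\<^sup>2))) / (1 - x\<^sup>2) ^ n)"
        using True y by (simp add: bump_term_def abs_mult)
      also have "\<dots> \<le> B * (fact (n + 2) * (1 - x\<^sup>2)\<^sup>2)"
        using True y B(1) by (intro mult_mono B(2) power_div_exp_bound) auto
      finally show ?thesis
        by (simp add: mult.assoc)
    qed (use B(1) in \<open>auto simp: bump_term_def\<close>)
  qed (use B(1) in auto)
qed

lemma bump_term_deriv:
  obtains q where
    "\<And>x. (bump_term p n has_real_derivative bump_term q (n + 2) x) (at x)"
proof
  define q where "q = pderiv p * [:1, 0, -1:]\<^sup>2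
    + Polynomial.smult (2 * real n) ([:0, 1:] * p * [:1, 0, -1:]) - Polynomial.smult 2 ([:0, 1:] * p)"
  have q: "poly q x = poly (pderiv p) x * (1 - x\<^sup>2)\<^sup>2 + 2 * n * x * poly p x * (1 - x\<^sup>2)
      - 2 * x * poly p x" for x :: real
    by (simp add: q_def algebra_simps power2_eq_square)
  fix x :: real
  consider "\<bar>x\<bar> < 1" | "\<bar>x\<bar> > 1" | "\<bar>x\<bar> = 1"
    by linarith
  thus "(bump_term p n has_real_derivative bump_term q (n + 2) x) (at x)"
  proof cases
    case 1
    hence y: "0 < 1 - x\<^sup>2"
      by (simp add: abs_less_one_sq)
    have "((\<lambda>x. poly p x / (1 - x\<^sup>2) ^ n * exp (- (1 / (1 - x\<^sup>2)))) has_real_derivative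
        bump_term q (n + 2) x) (at x)"
    proof -
      define w where "w = 1 - x\<^sup>2"
      have w: "w > 0" using y by (simp add: w_def)
      have dw: "((\<lambda>x. 1 - x\<^sup>2) has_real_derivative - (2 * x)) (at x)"
        by (auto intro!: derivative_eq_intros)
      have "((\<lambda>x. exp (- (1 / (1 - x\<^sup>2)))) has_real_derivative
          exp (- (1 / w)) * (- (2 * x) / w\<^sup>2)) (at x)"
        unfolding w_def by (rule derivative_eq_intros dw refl)+
          (use y in \<open>auto simp: power2_eq_square\<close>)
      moreover have "((\<lambda>x. poly p x / (1 - x\<^sup>2) ^ n) has_real_derivative
          (poly (pderiv p) x * w ^ n - poly p x * (n * w ^ (n - 1) * (- (2 * x)))) / (w ^ n * w ^ n)) (at x)"
        unfolding w_def by (rule derivative_eq_intros dw refl)+ (use y in \<open>auto simp: algebra_simps\<close>)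
      ultimately have "((\<lambda>x. poly p x / (1 - x\<^sup>2) ^ n * exp (- (1 / (1 - x\<^sup>2)))) has_real_derivative
        ((poly (pderiv p) x * w ^ n - poly p x * (n * w ^ (n - 1) * (- (2 * x)))) / (w ^ n * w ^ n) * exp (- (1 / w))
         + poly p x / w ^ n * (exp (- (1 / w)) * (- (2 * x) / w\<^sup>2)))) (at x)"
        unfolding w_def by (auto dest: DERIV_mult simp: algebra_simps)
      also have "(poly (pderiv p) x * w ^ n - poly p x * (n * w ^ (n - 1) * (- (2 * x)))) / (w ^ n * w ^ n) * exp (- (1 / w))
         + poly p x / w ^ n * (exp (- (1 / w)) * (- (2 * x) / w\<^sup>2)) = bump_term q (n + 2) x"
      proof -
        have pq: "poly q x = poly (pderiv p) x * w\<^sup>2 + 2 * n * x * poly p x * w - 2 * x * poly p x"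
          by (simp add: q w_def)
        have n: "n * w ^ (n - 1) / w ^ n = n / w"
          using w by (cases n) auto
        have "(poly (pderiv p) x * w ^ n - poly p x * (n * w ^ (n - 1) * (- (2 * x)))) / (w ^ n * w ^ n)
            = (poly (pderiv p) x + 2 * x * poly p x * (n * w ^ (n - 1) / w ^ n)) / w ^ n"
          using w by (simp add: field_simps)
        also have "\<dots> = (poly (pderiv p) x * w\<^sup>2 + 2 * n * x * poly p x * w) / w ^ (n + 2)"
          unfolding n using w by (simp add: field_simps power_add power2_eq_square)
        finally have lhs: "(poly (pderiv p) x * w ^ n - poly p x * (n * w ^ (n - 1) * (- (2 * x)))) / (w ^ n * w ^ n)
            = (poly (pderiv p) x * w\<^sup>2 + 2 * n * x * poly p x * w) / w ^ (n + 2)" .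
        have rhs: "bump_term q (n + 2) x = poly q x / w ^ (n + 2) * exp (- (1 / w))"
          using 1 by (simp add: bump_term_def w_def)
        show ?thesis
          unfolding lhs rhs pq using w by (simp add: field_simps power_add power2_eq_square)
      qed
      finally show ?thesis .
    qed
    thus ?thesis
      by (rule has_field_derivative_transform_within_open[where S = "{-1<..<1}"])
         (use 1 in \<open>auto simp: bump_term_def\<close>)
  next
    case 2
    have "((\<lambda>x. 0) has_real_derivative 0) (at x)"
      by simp
    hence "(bump_term p n has_real_derivative 0) (at x)"
      by (rule has_field_derivative_transform_within_open[where S = "{x. \<bar>x\<bar> > 1}"])
         (use 2 in \<open>auto simp: bump_term_def intro!: open_Collect_less continuous_intros\<close>)
    thus ?thesis
      using 2 by (simp add: bump_term_def)
  next
    case 3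
    obtain B where B: "0 \<le> B" "\<And>x. \<bar>bump_term p n x\<bar> \<le> B * (1 - x\<^sup>2)\<^sup>2"
      using bump_term_bound by blast
    have sq: "x\<^sup>2 = 1"
      using 3 by (metis abs_1 power2_abs power_one)
    have "\<bar>(bump_term p n y - bump_term p n x) / (y - x)\<bar> \<le> B * (\<bar>y - x\<bar> * (y + x)\<^sup>2)" for y
    proof (cases "y = x")
      case False
      have "\<bar>bump_term p n y\<bar> \<le> B * (\<bar>y - x\<bar>\<^sup>2 * (y + x)\<^sup>2)"
        using B(2)[of y] by (simp add: sq[symmetric] power2_eq_square algebra_simps)
      hence "\<bar>bump_term p n y\<bar> / \<bar>y - x\<bar> \<le> B * (\<bar>y - x\<bar>\<^sup>2 * (y + x)\<^sup>2) / \<bar>y - x\<bar>"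
        by (rule divide_right_mono) simp
      also have "\<dots> = B * (\<bar>y - x\<bar> * (y + x)\<^sup>2)"
        using False by (cases "y < x") (simp_all add: power2_eq_square)
      finally show ?thesis
        using 3 by (simp add: bump_term_def)
    qed auto
    hence "eventually (\<lambda>y. norm ((bump_term p n y - bump_term p n x) / (y - x))
        \<le> B * (\<bar>y - x\<bar> * (y + x)\<^sup>2)) (at x)"
      by (intro always_eventually) simp
    moreover have "((\<lambda>y. B * (\<bar>y - x\<bar> * (y + x)\<^sup>2)) \<longlongrightarrow> 0) (at x)"
      by (auto intro!: tendsto_eq_intros)
    ultimately have "((\<lambda>y. (bump_term p n y - bump_term p n x) / (y - x)) \<longlongrightarrow> 0) (at x)"
      by (rule Lim_null_comparison)
    thus ?thesis
      using 3 by (simp add: has_field_derivative_iff bump_term_def)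
  qed
qed

lemma bump_scaled_higher_deriv:
  assumes "R > 0"
  shows "\<exists>q m. (deriv ^^ j) (\<lambda>x. bump_term p n (x / R)) = (\<lambda>x. bump_term q m (x / R))"
proof (induction j)
  case 0
  thus ?case
    by auto
next
  case (Suc j)
  obtain q m where q: "(deriv ^^ j) (\<lambda>x. bump_term p n (x / R)) = (\<lambda>x. bump_term q m (x / R))"
    using Suc.IH by blast
  obtain q' where q': "\<And>x. (bump_term q m has_real_derivative bump_term q' (m + 2) x) (at x)"
    using bump_term_deriv by blast
  have "deriv (\<lambda>x. bump_term q m (x / R)) x = bump_term (Polynomial.smult (1 / R) q') (m + 2) (x / R)" for x
  proof (rule DERIV_imp_deriv)
    have "((\<lambda>x. bump_term q m (x / R)) has_real_derivative bump_term q' (m + 2) (x / R) * (1 / R)) (at x)"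
      by (rule DERIV_chain2[OF q']) (use assms in \<open>auto intro!: derivative_eq_intros\<close>)
    thus "((\<lambda>x. bump_term q m (x / R)) has_real_derivative
        bump_term (Polynomial.smult (1 / R) q') (m + 2) (x / R)) (at x)"
      by (simp add: bump_term_def mult_ac split: if_splits)
  qed
  hence "(deriv ^^ Suc j) (\<lambda>x. bump_term p n (x / R))
      = (\<lambda>x. bump_term (Polynomial.smult (1 / R) q') (m + 2) (x / R))"
    unfolding funpow.simps o_apply q by (intro ext)
  thus ?case
    by blast
qed

lemma bump_term_differentiable:
  assumes "R > 0"
  shows "(\<lambda>x. bump_term p n (x / R)) differentiable (at x)"
proof -
  obtain q where q: "\<And>x. (bump_term p n has_real_derivative bump_term q (n + 2) x) (at x)"
    using bump_term_deriv by blast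
  have "((\<lambda>x. bump_term p n (x / R)) has_real_derivative bump_term q (n + 2) (x / R) * (1 / R)) (at x)"
    by (rule DERIV_chain2[OF q]) (use assms in \<open>auto intro!: derivative_eq_intros\<close>)
  thus ?thesis
    using real_differentiable_def by blast
qed


definition bump :: "real \<Rightarrow> real \<Rightarrow> real" where
  "bump r x = bump_term 1 0 (x / (2 * r))"

lemma bump_eq_0:
  assumes "r > 0" "\<bar>x\<bar> \<ge> 2 * r"
  shows "bump r x = 0"
  using assms by (simp add: bump_def bump_term_def)

lemma abs_bump_le: "\<bar>bump r x\<bar> \<le> 1"
proof -
  have "\<bar>bump_term 1 0 y\<bar> \<le> 1" for y
    by (simp add: bump_term_def abs_less_one_sq)
  thus ?thesis
    by (simp add: bump_def)
qed

lemma bump_ge: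
  assumes "r > 0" "\<bar>x\<bar> \<le> r"
  shows "exp (- (4 / 3)) \<le> bump r x"
proof -
  have *: "\<bar>x / (2 * r)\<bar> \<le> 1 / 2"
    using assms by simp
  hence "(x / (2 * r))\<^sup>2 \<le> (1 / 2)\<^sup>2"
    using abs_le_square_iff[of "x / (2 * r)" "1 / 2"] by simp
  hence "3 / 4 \<le> 1 - (x / (2 * r))\<^sup>2"
    by (simp add: power2_eq_square)
  hence "1 / (1 - (x / (2 * r))\<^sup>2) \<le> 1 / (3 / 4)"
    by (intro divide_left_mono) auto
  thus ?thesis
    using * by (simp add: bump_def bump_term_def del: abs_divide)
qed

lemma bump_test_function:
  assumes "r > 0"
  shows "bump r \<in> test_functions"
proof -
  have bump_r: "bump r = (\<lambda>x. bump_term 1 0 (x / (2 * r)))"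
    by (simp add: bump_def fun_eq_iff)
  have "(deriv ^^ n) (bump r) differentiable (at x)" for n x
  proof -
    obtain q m where "(deriv ^^ n) (bump r) = (\<lambda>x. bump_term q m (x / (2 * r)))"
      using bump_scaled_higher_deriv[of "2 * r"] assms unfolding bump_r by fastforce
    thus ?thesis
      using bump_term_differentiable[of "2 * r"] assms by simp
  qed
  moreover have "{x. bump r x \<noteq> 0} \<subseteq> {-(2 * r)..2 * r}"
    using bump_eq_0[OF assms] by (force simp: abs_le_iff not_le)
  hence "bounded {x. bump r x \<noteq> 0}"
    using bounded_closed_interval bounded_subset by blast
  ultimately show ?thesis
    by (simp add: test_functions_def)
qed

text \<open>The constant does not depend on \<open>r\<close>: this is the scaling that makes the energy small.\<close>
lemma bump_deriv_bound:
  obtains D where "0 \<le> D" "\<And>r x. r > 0 \<Longrightarrow> \<bar>deriv (bump r) x\<bar> \<le> D / r"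
    "\<And>r x. r > 0 \<Longrightarrow> \<bar>x\<bar> \<ge> 2 * r \<Longrightarrow> deriv (bump r) x = 0"
proof -
  obtain q where q: "\<And>x. (bump_term 1 0 has_real_derivative bump_term q 2 x) (at x)"
    using bump_term_deriv[of 1 0] by (metis add_0)
  obtain B where B: "0 \<le> B" "\<And>x. \<bar>bump_term q 2 x\<bar> \<le> B * (1 - x\<^sup>2)\<^sup>2"
    using bump_term_bound by blast
  have le: "\<bar>bump_term q 2 x\<bar> \<le> B" for x
  proof (cases "\<bar>x\<bar> < 1")
    case True
    hence "(1 - x\<^sup>2)\<^sup>2 \<le> 1\<^sup>2"
      by (intro power_mono) (auto simp: abs_less_one_sq)
    hence "B * (1 - x\<^sup>2)\<^sup>2 \<le> B"
      using B(1) by (simp add: mult_left_le)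
    thus ?thesis
      using B(2)[of x] by simp
  qed (use B(1) in \<open>simp add: bump_term_def\<close>)
  have D: "deriv (bump r) x = bump_term q 2 (x / (2 * r)) * (1 / (2 * r))" if "r > 0" for r x
  proof (rule DERIV_imp_deriv)
    show "(bump r has_real_derivative bump_term q 2 (x / (2 * r)) * (1 / (2 * r))) (at x)"
      unfolding bump_def[abs_def]
      by (rule DERIV_chain2[where g = "\<lambda>x. x / (2 * r)"])
         (use q that in \<open>auto intro!: derivative_eq_intros\<close>)
  qed
  show thesis
  proof (rule that[of "B / 2"])
    fix r x :: real
    assume r: "r > 0"
    have "\<bar>deriv (bump r) x\<bar> = \<bar>bump_term q 2 (x / (2 * r))\<bar> / (2 * r)"
      using r by (simp add: D abs_mult)
    also have "\<dots> \<le> B / (2 * r)"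
      using r by (intro divide_right_mono le) auto
    finally show "\<bar>deriv (bump r) x\<bar> \<le> B / 2 / r"
      by simp
    assume "\<bar>x\<bar> \<ge> 2 * r"
    thus "deriv (bump r) x = 0"
      using r by (simp add: D bump_term_def)
  qed (use B(1) in simp)
qed

section \<open>The chain rule for smooth cylinder data\<close>

lemma smooth_bounded_partial:
  assumes "\<Phi> \<in> smooth_bounded k" "i < k"
  shows "((\<lambda>t. \<Phi> (x(i := t))) has_real_derivative partial_deriv i \<Phi> (x(i := s))) (at s)"
    and "continuous_on UNIV (partial_deriv i \<Phi>)"
proof -
  from assms(1) have *: "set is \<subseteq> {..<k} \<Longrightarrow>
      continuous_on UNIV (foldr partial_deriv is \<Phi>) \<and>
      (\<forall>i<k. \<forall>x. (\<lambda>t. foldr partial_deriv is \<Phi> (x(i := t))) differentiable (at (x i)))" for "is"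
    by (auto simp: smooth_bounded_def Let_def)
  show "continuous_on UNIV (partial_deriv i \<Phi>)"
    using *[of "[i]"] assms(2) by simp
  have "(\<lambda>t. \<Phi> (y(i := t))) differentiable (at (y i))" for y
    using *[of "[]"] assms(2) by simp
  from this[of "x(i := s)"] have "(\<lambda>t. \<Phi> (x(i := t))) differentiable (at s)"
    by simp
  thus "((\<lambda>t. \<Phi> (x(i := t))) has_real_derivative partial_deriv i \<Phi> (x(i := s))) (at s)"
    by (simp add: partial_deriv_def DERIV_deriv_iff_real_differentiable)
qed

text \<open>The mean value theorem irrespective of the order of the end points.\<close>
lemma real_mvt_segment:
  fixes f f' :: "real \<Rightarrow> real"
  assumes "\<And>t. (f has_real_derivative f' t) (at t)"
  obtains z where "\<bar>z - a\<bar> \<le> \<bar>b - a\<bar>" "f b - f a = f' z * (b - a)"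
proof -
  consider "a < b" | "a = b" | "b < a"
    by linarith
  thus thesis
  proof cases
    case 1
    then obtain z where "a < z" "z < b" "f b - f a = (b - a) * f' z"
      using MVT2[of a b f f'] assms by blast
    thus thesis
      by (intro that[of z]) auto
  next
    case 2
    thus thesis
      by (intro that[of a]) auto
  next
    case 3
    then obtain z where z: "b < z" "z < a" "f a - f b = (a - b) * f' z"
      using MVT2[of b a f f'] assms by blast
    show thesis
      by (intro that[of z]) (use z in \<open>auto simp: algebra_simps\<close>)
  qed
qed

lemma tendsto_pointwise_function:
  fixes g :: "'b \<Rightarrow> nat \<Rightarrow> real"
  assumes "\<And>i. ((\<lambda>t. g t i) \<longlongrightarrow> l i) G"
  shows "(g \<longlongrightarrow> l) G"
proof -
  have "limitin (product_topology (\<lambda>i. euclidean) UNIV) g l G"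
    using assms by (simp add: limitin_componentwise)
  thus ?thesis
    by (simp add: euclidean_product_topology)
qed

text \<open>
  The arguments \<open>a\<^sub>0, a\<^sub>1, \<dots>\<close> are released one at a time. Releasing \<open>a\<^sub>j\<close> changes \<open>\<Phi>\<close> by the partial
  derivative at an intermediate point times the increment of \<open>a\<^sub>j\<close>, by the mean value theorem, and
  continuity of the partial derivative identifies the limit.
\<close>
lemma smooth_bounded_chain_rule:
  fixes a :: "nat \<Rightarrow> real \<Rightarrow> real"
  assumes \<Phi>: "\<Phi> \<in> smooth_bounded k"
    and a: "\<And>i. i < k \<Longrightarrow> (a i has_real_derivative d i) (at s)"
  shows "((\<lambda>t. \<Phi> (\<lambda>i. a i t)) has_real_derivative
           (\<Sum>i<k. partial_deriv i \<Phi> (\<lambda>i. a i s) * d i)) (at s)"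
proof -
  \<comment> \<open>The coordinates below \<open>j\<close> follow the curve, the others are frozen at time \<open>s\<close>.\<close>
  define p where "p j t = (\<lambda>i. if i < j then a i t else a i s)" for j :: nat and t
  have ps: "p j s = (\<lambda>i. a i s)" for j
    by (auto simp: p_def)
  have "((\<lambda>t. \<Phi> (p j t)) has_real_derivative
      (\<Sum>i<j. partial_deriv i \<Phi> (\<lambda>i. a i s) * d i)) (at s)" if "j \<le> k" for j
    using that
  proof (induction j)
    case 0
    thus ?case
      by (simp add: p_def)
  next
    case (Suc j)
    hence j: "j < k"
      by simp
    have "\<exists>z. \<bar>z - a j s\<bar> \<le> \<bar>a j t - a j s\<bar> \<and>
        \<Phi> ((p j t)(j := a j t)) - \<Phi> ((p j t)(j := a j s))
        = partial_deriv j \<Phi> ((p j t)(j := z)) * (a j t - a j s)" for t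
      using real_mvt_segment[OF smooth_bounded_partial(1)[OF \<Phi> j]] by metis
    then obtain z where z: "\<And>t. \<bar>z t - a j s\<bar> \<le> \<bar>a j t - a j s\<bar>"
      "\<And>t. \<Phi> ((p j t)(j := a j t)) - \<Phi> ((p j t)(j := a j s))
        = partial_deriv j \<Phi> ((p j t)(j := z t)) * (a j t - a j s)"
      by metis
    have upd: "(p j t)(j := a j t) = p (Suc j) t" "(p j t)(j := a j s) = p j t" for t
      by (auto simp: p_def less_Suc_eq)
    have cont: "(a i \<longlongrightarrow> a i s) (at s)" if "i < k" for i
      using DERIV_isCont[OF a[OF that]] by (simp add: isCont_def)
    have "(z \<longlongrightarrow> a j s) (at s)"
    proof -
      have "((\<lambda>t. a j t - a j s) \<longlongrightarrow> 0) (at s)"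
        using cont[OF j] by (simp add: LIM_zero)
      hence "((\<lambda>t. \<bar>a j t - a j s\<bar>) \<longlongrightarrow> 0) (at s)"
        by (simp add: tendsto_rabs_zero_iff)
      hence "((\<lambda>t. z t - a j s) \<longlongrightarrow> 0) (at s)"
        by (rule Lim_null_comparison[rotated]) (use z(1) in auto)
      thus ?thesis
        by (simp add: LIM_zero_iff)
    qed
    hence "((\<lambda>t. (p j t)(j := z t)) \<longlongrightarrow> (\<lambda>i. a i s)) (at s)"
    proof (intro tendsto_pointwise_function)
      fix i
      assume "(z \<longlongrightarrow> a j s) (at s)"
      thus "((\<lambda>t. ((p j t)(j := z t)) i) \<longlongrightarrow> a i s) (at s)"
        using cont[of i] j by (cases "i = j"; cases "i < j") (auto simp: p_def)
    qed
    moreover have "isCont (partial_deriv j \<Phi>) (\<lambda>i. a i s)"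
      using smooth_bounded_partial(2)[OF \<Phi> j]
      by (simp add: continuous_on_eq_continuous_at)
    ultimately have "((\<lambda>t. partial_deriv j \<Phi> ((p j t)(j := z t)))
        \<longlongrightarrow> partial_deriv j \<Phi> (\<lambda>i. a i s)) (at s)"
      by (rule isCont_tendsto_compose[rotated])
    moreover have "((\<lambda>t. (a j t - a j s) / (t - s)) \<longlongrightarrow> d j) (at s)"
      using a[OF j] by (simp add: has_field_derivative_iff)
    ultimately have "((\<lambda>t. partial_deriv j \<Phi> ((p j t)(j := z t)) * ((a j t - a j s) / (t - s)))
        \<longlongrightarrow> partial_deriv j \<Phi> (\<lambda>i. a i s) * d j) (at s)"
      by (rule tendsto_mult)
    hence "((\<lambda>t. \<Phi> (p (Suc j) t) - \<Phi> (p j t)) has_real_derivative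
        partial_deriv j \<Phi> (\<lambda>i. a i s) * d j) (at s)"
      using z(2) by (simp add: has_field_derivative_iff upd ps)
    from DERIV_add[OF this Suc.IH] Suc.prems show ?case
      by (simp add: add.commute)
  qed
  from this[of k] have "((\<lambda>t. \<Phi> (p k t)) has_real_derivative
      (\<Sum>i<k. partial_deriv i \<Phi> (\<lambda>i. a i s) * d i)) (at s)"
    by simp
  moreover have "\<Phi> (p k t) = \<Phi> (\<lambda>i. a i t)" for t
    using \<Phi> unfolding smooth_bounded_def by (auto simp: p_def)
  ultimately show ?thesis
    by simp
qed



text \<open>
  Shifting the phase by \<open>\<pi>/2\<close> instead of switching between sine and cosine keeps all iterated
  derivatives in one family.
\<close>
lemma partial_deriv_sine:
  "partial_deriv 0 (\<lambda>x. c * sin (x 0 / L + b)) = (\<lambda>x. c / L * sin (x 0 / L + (b + pi / 2)))"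
proof
  fix x :: "nat \<Rightarrow> real"
  have "((\<lambda>t. c * sin (t / L + b)) has_real_derivative c * (cos (x 0 / L + b) * (1 / L))) (at (x 0))"
    by (auto intro!: derivative_eq_intros simp: divide_inverse)
  hence "deriv (\<lambda>t. c * sin (t / L + b)) (x 0) = c / L * sin (x 0 / L + b + pi / 2)"
    by (subst sin_add) (auto dest: DERIV_imp_deriv)
  thus "partial_deriv 0 (\<lambda>x. c * sin (x 0 / L + b)) x = c / L * sin (x 0 / L + (b + pi / 2))"
    by (simp add: partial_deriv_def add.assoc)
qed

lemma sine_smooth_bounded:
  "(\<lambda>x. c * sin (x 0 / L + b)) \<in> smooth_bounded 1"
proof -
  have form: "\<exists>c' b'. foldr partial_deriv is (\<lambda>x. c * sin (x 0 / L + b)) = (\<lambda>x. c' * sin (x 0 / L + b'))"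
    if "set is \<subseteq> {..<1}" for "is"
    using that
  proof (induction "is")
    case (Cons i "is")
    then obtain c' b' where "foldr partial_deriv is (\<lambda>x. c * sin (x 0 / L + b)) = (\<lambda>x. c' * sin (x 0 / L + b'))"
      by auto
    hence "foldr partial_deriv (i # is) (\<lambda>x. c * sin (x 0 / L + b))
        = (\<lambda>x. c' / L * sin (x 0 / L + (b' + pi / 2)))"
      using Cons.prems by (simp add: partial_deriv_sine)
    thus ?case
      by blast
  qed auto
  have regular: "continuous_on UNIV (\<lambda>x::nat \<Rightarrow> real. c * sin (x 0 / L + b))
      \<and> bounded (range (\<lambda>x::nat \<Rightarrow> real. c * sin (x 0 / L + b)))
      \<and> (\<forall>i<1::nat. \<forall>x. (\<lambda>t. c * sin ((x(i := t)) 0 / L + b)) differentiable (at (x i)))" for c b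
  proof (intro conjI allI impI)
    show "continuous_on UNIV (\<lambda>x::nat \<Rightarrow> real. c * sin (x 0 / L + b))"
      unfolding divide_inverse by (intro continuous_intros continuous_on_product_coordinates)
    show "bounded (range (\<lambda>x::nat \<Rightarrow> real. c * sin (x 0 / L + b)))"
      by (rule boundedI[of _ "\<bar>c\<bar>"]) (auto simp: abs_mult mult_left_le)
    fix i :: nat and x :: "nat \<Rightarrow> real" assume "i < 1"
    moreover have "((\<lambda>t. c * sin (t / L + b)) has_real_derivative c * (cos (x 0 / L + b) * (1 / L))) (at (x 0))"
      by (auto intro!: derivative_eq_intros simp: divide_inverse)
    ultimately show "(\<lambda>t. c * sin ((x(i := t)) 0 / L + b)) differentiable (at (x i))"
      by (auto simp: real_differentiable_def)
  qed
  have "continuous_on UNIV \<Psi> \<and> bounded (range \<Psi>)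
      \<and> (\<forall>i<1. \<forall>x. (\<lambda>t. \<Psi> (x(i := t))) differentiable (at (x i)))"
    if \<Psi>: "set is \<subseteq> {..<1}" "\<Psi> = foldr partial_deriv is (\<lambda>x. c * sin (x 0 / L + b))" for "is" \<Psi>
  proof -
    obtain c' b' where "\<Psi> = (\<lambda>x. c' * sin (x 0 / L + b'))"
      using form \<Psi> by blast
    thus ?thesis
      using regular by simp
  qed
  thus ?thesis
    by (simp add: smooth_bounded_def Let_def)
qed

section \<open>The square field of a cylinder function\<close>

definition config :: "nat set \<Rightarrow> (nat \<Rightarrow> real) \<Rightarrow> real measure" where
  "config I x = distr (count_space I) borel x"

definition locally_finite :: "nat set \<Rightarrow> (nat \<Rightarrow> real) \<Rightarrow> bool" where
  "locally_finite I x \<longleftrightarrow> (\<forall>K. compact K \<longrightarrow> finite {i \<in> I. x i \<in> K})"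

lemma configurations_iff:
  "\<gamma> \<in> configurations \<longleftrightarrow> (\<exists>I x. \<gamma> = config I x \<and> locally_finite I x)"
  by (auto simp: configurations_def config_def locally_finite_def)

lemma test_function_deriv:
  assumes "u \<in> test_functions"
  shows "(u has_real_derivative deriv u s) (at s)"
    and "u \<in> borel_measurable borel" "deriv u \<in> borel_measurable borel"
proof -
  have *: "(deriv ^^ n) u differentiable (at x)" for n x
    using assms by (simp add: test_functions_def)
  show "(u has_real_derivative deriv u s) (at s)"
    using *[of 0] by (simp add: DERIV_deriv_iff_real_differentiable)
  have "continuous_on UNIV ((deriv ^^ n) u)" for n
    using * by (simp add: continuous_at_imp_continuous_on differentiable_imp_continuous_within)
  from this[of 0] this[of 1] show "u \<in> borel_measurable borel" "deriv u \<in> borel_measurable borel"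
    by (auto intro: borel_measurable_continuous_onI)
qed

lemma test_function_support:
  assumes "u \<in> test_functions" "x \<notin> closure {x. u x \<noteq> 0}"
  shows "u x = 0" "deriv u x = 0"
proof -
  have zero: "u y = 0" if "y \<notin> closure {x. u x \<noteq> 0}" for y
    using that closure_subset[of "{x. u x \<noteq> 0}"] by blast
  thus "u x = 0"
    using assms(2) by blast
  have "((\<lambda>_. 0) has_real_derivative 0) (at x)"
    by simp
  hence "(u has_real_derivative 0) (at x)"
  proof (rule has_field_derivative_transform_within_open)
    show "open (- closure {x. u x \<noteq> 0})"
      by (intro open_Compl closed_closure)
    show "x \<in> - closure {x. u x \<noteq> 0}"
      using assms(2) by blast
    show "0 = u y" if "y \<in> - closure {x. u x \<noteq> 0}" for y
      using that zero[of y] by (metis ComplD)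
  qed
  thus "deriv u x = 0"
    by (rule DERIV_imp_deriv)
qed

lemma lin_stat_config:
  assumes "u \<in> borel_measurable borel" "finite J" "J \<subseteq> I"
    and "\<And>i. i \<in> I - J \<Longrightarrow> u (x i) = 0"
  shows "lin_stat u (config I x) = (\<Sum>i\<in>J. u (x i))"
proof -
  have fin: "finite {i \<in> I. u (x i) \<noteq> 0}"
    by (rule finite_subset[OF _ assms(2)]) (use assms(4) in auto)
  have "lin_stat u (config I x) = (\<integral>i. u (x i) \<partial>count_space I)"
    unfolding lin_stat_def config_def by (rule integral_distr) (use assms(1) in auto)
  also have "\<dots> = (\<Sum>i | i \<in> I \<and> u (x i) \<noteq> 0. u (x i))"
    by (rule lebesgue_integral_count_space_finite_support[OF fin])
  also have "\<dots> = (\<Sum>i\<in>J. u (x i))"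
    by (rule sum.mono_neutral_left) (use assms in auto)
  finally show ?thesis .
qed

lemma locally_finite_move:
  assumes "locally_finite I x"
  shows "locally_finite I (x(l := t))"
  unfolding locally_finite_def
proof (intro allI impI)
  fix K :: "real set"
  assume "compact K"
  hence "finite (insert l {i \<in> I. x i \<in> K})"
    using assms by (simp add: locally_finite_def)
  thus "finite {i \<in> I. (x(l := t)) i \<in> K}"
    by (rule rev_finite_subset) auto
qed

text \<open>A linear statistic only feels the atom \<open>l\<close> that is moved to \<open>t\<close>.\<close>
lemma lin_stat_move:
  assumes "locally_finite I x" "l \<in> I" "u \<in> test_functions"
  shows "lin_stat u (config I (x(l := t))) = lin_stat u (config I x) - u (x l) + u t"
proof -
  define J where "J = insert l {i \<in> I. x i \<in> closure {x. u x \<noteq> 0}}"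
  have J: "finite J" "J \<subseteq> I" "l \<in> J"
    using assms by (auto simp: J_def locally_finite_def test_functions_def)
  have zero: "u (x i) = 0" "u ((x(l := t)) i) = 0" if "i \<in> I - J" for i
  proof -
    from that have "i \<noteq> l" "x i \<notin> closure {x. u x \<noteq> 0}"
      by (auto simp: J_def)
    from test_function_support(1)[OF assms(3) this(2)] this(1)
    show "u (x i) = 0" "u ((x(l := t)) i) = 0"
      by simp_all
  qed
  note stat = lin_stat_config[OF test_function_deriv(2)[OF assms(3)] J(1,2)]
  have "lin_stat u (config I (x(l := t))) = (\<Sum>i\<in>J. u ((x(l := t)) i))"
    by (rule stat) (rule zero)
  also have "\<dots> = (\<Sum>i\<in>J - {l}. u (x i)) + u t"
    using J by (subst sum.remove[of _ l]) auto
  also have "(\<Sum>i\<in>J - {l}. u (x i)) = (\<Sum>i\<in>J. u (x i)) - u (x l)"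
    using J by (subst sum.remove[of J l]) auto
  also have "(\<Sum>i\<in>J. u (x i)) = lin_stat u (config I x)"
    by (rule stat[symmetric]) (rule zero)
  finally show ?thesis .
qed

lemma cylinder_rep_move_atom:
  assumes "cylinder_rep k \<Phi> u U" "locally_finite I x" "l \<in> I"
  shows "((\<lambda>t. U (config I (x(l := t)))) has_real_derivative
    (\<Sum>i<k. partial_deriv i \<Phi> (\<lambda>i. lin_stat (u i) (config I x)) * deriv (u i) (x l))) (at (x l))"
proof -
  have \<Phi>: "\<Phi> \<in> smooth_bounded k" and u: "\<And>i. i < k \<Longrightarrow> u i \<in> test_functions"
    and U: "\<And>\<gamma>. \<gamma> \<in> configurations \<Longrightarrow> U \<gamma> = \<Phi> (\<lambda>i. lin_stat (u i) \<gamma>)"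
    using assms(1) unfolding cylinder_rep_def by blast+
  have "((\<lambda>t. \<Phi> (\<lambda>i. lin_stat (u i) (config I (x(l := t))))) has_real_derivative
      (\<Sum>i<k. partial_deriv i \<Phi> (\<lambda>i. lin_stat (u i) (config I (x(l := x l))))
        * deriv (u i) (x l))) (at (x l))"
  proof (rule smooth_bounded_chain_rule[OF \<Phi>])
    fix i
    assume "i < k"
    hence "u i \<in> test_functions"
      by (rule u)
    thus "((\<lambda>t. lin_stat (u i) (config I (x(l := t)))) has_real_derivative deriv (u i) (x l)) (at (x l))"
      using test_function_deriv(1)[of "u i" "x l"]
      by (auto simp: lin_stat_move[OF assms(2,3)] intro!: derivative_eq_intros)
  qed
  moreover have "config I (x(l := t)) \<in> configurations" for t
    using locally_finite_move[OF assms(2)] configurations_iff by blast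
  ultimately show ?thesis
    by (simp add: U)
qed

text \<open>The square field computed from one particular representation of a cylinder function.\<close>
definition gradient_sq ::
    "nat \<Rightarrow> ((nat \<Rightarrow> real) \<Rightarrow> real) \<Rightarrow> (nat \<Rightarrow> real \<Rightarrow> real) \<Rightarrow> real measure \<Rightarrow> real" where
  "gradient_sq k \<Phi> u \<gamma> = (\<Sum>i<k. \<Sum>j<k.
     partial_deriv i \<Phi> (\<lambda>l. lin_stat (u l) \<gamma>) * partial_deriv j \<Phi> (\<lambda>l. lin_stat (u l) \<gamma>) *
     lin_stat (square_field_R (u i) (u j)) \<gamma>)"

text \<open>
  The right-hand side mentions only \<open>U\<close>, and \<open>J\<close> may be any finite set of atoms that covers the
  supports, so one \<open>J\<close> can serve two representations of \<open>U\<close>.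
\<close>
lemma gradient_sq_config:
  assumes "cylinder_rep k \<Phi> u U" "locally_finite I x" "finite J" "J \<subseteq> I"
    and J: "\<And>i l. i < k \<Longrightarrow> l \<in> I - J \<Longrightarrow> x l \<notin> closure {y. u i y \<noteq> 0}"
  shows "gradient_sq k \<Phi> u (config I x) =
    (\<Sum>l\<in>J. (deriv (\<lambda>t. U (config I (x(l := t)))) (x l))\<^sup>2)"
proof -
  have u: "\<And>i. i < k \<Longrightarrow> u i \<in> test_functions"
    using assms(1) unfolding cylinder_rep_def by blast
  let ?p = "\<lambda>i. partial_deriv i \<Phi> (\<lambda>l. lin_stat (u l) (config I x))"
  have stat: "lin_stat (square_field_R (u i) (u j)) (config I x) = (\<Sum>l\<in>J. deriv (u i) (x l) * deriv (u j) (x l))"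
    if ij: "i < k" "j < k" for i j
  proof -
    have "square_field_R (u i) (u j) \<in> borel_measurable borel"
      using test_function_deriv(3)[OF u[OF ij(1)]] test_function_deriv(3)[OF u[OF ij(2)]]
      unfolding square_field_R_def[abs_def] by simp
    hence "lin_stat (square_field_R (u i) (u j)) (config I x) = (\<Sum>l\<in>J. square_field_R (u i) (u j) (x l))"
      by (rule lin_stat_config[OF _ assms(3,4)])
         (use J[OF ij(1)] test_function_support(2)[OF u[OF ij(1)]] in \<open>auto simp: square_field_R_def\<close>)
    thus ?thesis
      by (simp add: square_field_R_def)
  qed
  have "gradient_sq k \<Phi> u (config I x)
      = (\<Sum>i<k. \<Sum>j<k. \<Sum>l\<in>J. (?p i * deriv (u i) (x l)) * (?p j * deriv (u j) (x l)))"
    unfolding gradient_sq_def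
    by (intro sum.cong refl) (simp add: stat sum_distrib_left mult_ac)
  also have "\<dots> = (\<Sum>l\<in>J. \<Sum>i<k. \<Sum>j<k. (?p i * deriv (u i) (x l)) * (?p j * deriv (u j) (x l)))"
    by (simp only: sum.swap[of _ J "{..<k}"])
  also have "\<dots> = (\<Sum>l\<in>J. (\<Sum>i<k. ?p i * deriv (u i) (x l))\<^sup>2)"
    by (simp add: power2_eq_square sum_product)
  also have "\<dots> = (\<Sum>l\<in>J. (deriv (\<lambda>t. U (config I (x(l := t)))) (x l))\<^sup>2)"
  proof (rule sum.cong[OF refl])
    fix l assume "l \<in> J"
    hence "l \<in> I" using assms(4) by blast
    from DERIV_imp_deriv[OF cylinder_rep_move_atom[OF assms(1,2) this]]
    show "(\<Sum>i<k. ?p i * deriv (u i) (x l))\<^sup>2 = (deriv (\<lambda>t. U (config I (x(l := t)))) (x l))\<^sup>2"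
      by simp
  qed
  finally show ?thesis .
qed

text \<open>This makes the definite description in the square field meaningful.\<close>
lemma gradient_sq_unique:
  assumes "cylinder_rep k \<Phi> u U" "cylinder_rep k' \<Phi>' u' U" "\<gamma> \<in> configurations"
  shows "gradient_sq k \<Phi> u \<gamma> = gradient_sq k' \<Phi>' u' \<gamma>"
proof -
  obtain I x where \<gamma>: "\<gamma> = config I x" and lf: "locally_finite I x"
    using assms(3) configurations_iff by blast
  define K where "K = (\<Union>i<k. closure {y. u i y \<noteq> 0}) \<union> (\<Union>i<k'. closure {y. u' i y \<noteq> 0})"
  have supp: "compact (closure {y. v i y \<noteq> 0})" if "cylinder_rep n \<Psi> v U" "i < n" for n \<Psi> v i
    using that unfolding cylinder_rep_def test_functions_def by blast
  have "compact K"
    unfolding K_def using supp[OF assms(1)] supp[OF assms(2)] by (intro compact_Un compact_UN) auto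
  hence fin: "finite {l \<in> I. x l \<in> K}"
    using lf unfolding locally_finite_def by blast
  have "gradient_sq k \<Phi> u (config I x) =
      (\<Sum>l | l \<in> I \<and> x l \<in> K. (deriv (\<lambda>t. U (config I (x(l := t)))) (x l))\<^sup>2)"
    by (rule gradient_sq_config[OF assms(1) lf fin]) (unfold K_def, blast+)
  also have "\<dots> = gradient_sq k' \<Phi>' u' (config I x)"
    by (rule gradient_sq_config[OF assms(2) lf fin, symmetric]) (unfold K_def, blast+)
  finally show ?thesis
    by (simp only: \<gamma>)
qed

lemma square_field_eq:
  assumes "cylinder_rep k \<Phi> u U" "\<gamma> \<in> configurations"
  shows "square_field U \<gamma> = gradient_sq k \<Phi> u \<gamma>"
  unfolding square_field_def
proof (rule the_equality)
  show "\<exists>k' \<Phi>' u'. cylinder_rep k' \<Phi>' u' U \<and> gradient_sq k \<Phi> u \<gamma> = (\<Sum>i<k'. \<Sum>j<k'.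
      partial_deriv i \<Phi>' (\<lambda>l. lin_stat (u' l) \<gamma>) * partial_deriv j \<Phi>' (\<lambda>l. lin_stat (u' l) \<gamma>) *
      lin_stat (square_field_R (u' i) (u' j)) \<gamma>)"
    using assms(1) gradient_sq_def by blast
next
  fix s
  assume "\<exists>k \<Phi> u. cylinder_rep k \<Phi> u U \<and> s = (\<Sum>i<k. \<Sum>j<k.
      partial_deriv i \<Phi> (\<lambda>l. lin_stat (u l) \<gamma>) * partial_deriv j \<Phi> (\<lambda>l. lin_stat (u l) \<gamma>) *
      lin_stat (square_field_R (u i) (u j)) \<gamma>)"
  thus "s = gradient_sq k \<Phi> u \<gamma>"
    using gradient_sq_unique[OF _ assms] unfolding gradient_sq_def by blast
qed

text \<open>A bounded substitute for the linear statistic, to which it converges for \<open>c = L \<rightarrow> \<infinity>\<close>.\<close>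
definition sine_stat :: "real \<Rightarrow> real \<Rightarrow> (real \<Rightarrow> real) \<Rightarrow> real measure \<Rightarrow> real" where
  "sine_stat c L u \<gamma> = c * sin (lin_stat u \<gamma> / L)"

lemma sine_stat_rep:
  assumes "u \<in> test_functions"
  shows "cylinder_rep 1 (\<lambda>x. c * sin (x 0 / L + 0)) (\<lambda>_. u) (sine_stat c L u)"
  using assms sine_smooth_bounded[of c L 0] by (simp add: cylinder_rep_def sine_stat_def)

lemma square_field_sine_stat:
  assumes "u \<in> test_functions" "\<gamma> \<in> configurations"
  shows "square_field (sine_stat c L u) \<gamma>
    = (c / L * cos (lin_stat u \<gamma> / L))\<^sup>2 * lin_stat (\<lambda>x. (deriv u x)\<^sup>2) \<gamma>"
proof -
  have "partial_deriv 0 (\<lambda>x. c * sin (x 0 / L + 0)) (\<lambda>_. lin_stat u \<gamma>)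
      = c / L * cos (lin_stat u \<gamma> / L)"
    unfolding partial_deriv_sine by (simp add: sin_add)
  moreover have "square_field_R u u = (\<lambda>x. (deriv u x)\<^sup>2)"
    by (simp add: square_field_R_def fun_eq_iff power2_eq_square)
  ultimately show ?thesis
    unfolding square_field_eq[OF sine_stat_rep[OF assms(1)] assms(2)] gradient_sq_def
    by (simp add: power2_eq_square)
qed

lemma square_field2_sine_stat:
  assumes "u \<in> test_functions" "\<gamma> \<in> configurations" "L \<noteq> 0"
  shows "square_field2 (sine_stat L L u) (sine_stat L L u) \<gamma>
    = (cos (lin_stat u \<gamma> / L))\<^sup>2 * lin_stat (\<lambda>x. (deriv u x)\<^sup>2) \<gamma>"
proof -
  have "(\<lambda>\<eta>. sine_stat L L u \<eta> + sine_stat L L u \<eta>) = sine_stat (2 * L) L u"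
    "(\<lambda>\<eta>. sine_stat L L u \<eta> - sine_stat L L u \<eta>) = sine_stat 0 L u"
    by (auto simp: sine_stat_def)
  thus ?thesis
    unfolding square_field2_def
    using assms(3) by (simp add: square_field_sine_stat[OF assms(1,2)] power_mult_distrib)
qed

section \<open>The squared sine kernel\<close>

text \<open>The square \<open>K(x,y)\<^sup>2\<close> depends only on the difference \<open>x - y\<close>.\<close>
definition kernel_sq :: "real \<Rightarrow> real" where
  "kernel_sq z = (sine_kernel z 0)\<^sup>2"

lemma sine_kernel_prod: "sine_kernel x y * sine_kernel y x = kernel_sq (x - y)"
proof -
  have flip: "pi * (y - x) = - (pi * (x - y))"
    by (simp only: right_diff_distrib minus_diff_eq)
  have "sin (pi * (y - x)) / (pi * (y - x)) = sin (pi * (x - y)) / (pi * (x - y))"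
    unfolding flip sin_minus by (rule minus_divide_divide)
  thus ?thesis
    unfolding kernel_sq_def sine_kernel_def power2_eq_square by (cases "x = y") simp_all
qed

lemma kernel_sq_nonneg: "0 \<le> kernel_sq z"
  by (simp add: kernel_sq_def)

lemma kernel_sq_le_1: "kernel_sq z \<le> 1"
proof -
  have "\<bar>sin (pi * z)\<bar> \<le> \<bar>pi * z\<bar>"
    by (rule abs_sin_x_le_abs_x)
  hence "\<bar>sine_kernel z 0\<bar> \<le> 1"
    by (auto simp: sine_kernel_def divide_le_eq)
  thus ?thesis
    by (simp add: kernel_sq_def abs_square_le_1)
qed

lemma borel_measurable_kernel_sq [measurable]: "kernel_sq \<in> borel_measurable borel"
  unfolding kernel_sq_def[abs_def] sine_kernel_def by measurable

definition row_integral :: "real set \<Rightarrow> real \<Rightarrow> real" where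
  "row_integral B x = (\<integral>y. indicator B y * kernel_sq (x - y) \<partial>lborel)"

definition pair_integral :: "real set \<Rightarrow> real set \<Rightarrow> real" where
  "pair_integral A B = (\<integral>x. indicator A x * row_integral B x \<partial>lborel)"

lemma integrable_row:
  assumes "B \<in> sets borel" "bounded B"
  shows "integrable lborel (\<lambda>y. indicat_real B y * kernel_sq (x - y))"
proof (rule Bochner_Integration.integrable_bound)
  show "integrable lborel (indicat_real B)"
    using assms emeasure_bounded_finite[where 'a = real] by (auto intro: integrable_real_indicator)
  show "(\<lambda>y. indicat_real B y * kernel_sq (x - y)) \<in> borel_measurable lborel"
    using assms(1) by measurable
qed (auto simp: indicator_def kernel_sq_nonneg kernel_sq_le_1)

lemma borel_measurable_row [measurable]:
  assumes [measurable]: "B \<in> sets borel"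
  shows "row_integral B \<in> borel_measurable borel"
proof -
  have "(\<lambda>x. \<integral>y. indicator B y * kernel_sq (x - y) \<partial>lborel) \<in> borel_measurable borel"
    by (rule sigma_finite_measure.borel_measurable_lebesgue_integral[OF sigma_finite_lborel]) measurable
  thus ?thesis
    by (simp add: row_integral_def[abs_def])
qed

lemma row_integral_nonneg: "0 \<le> row_integral B x"
  unfolding row_integral_def by (intro integral_nonneg_AE) (auto simp: kernel_sq_nonneg)

lemma row_integral_le:
  assumes "B \<in> sets borel" "bounded B"
  shows "row_integral B x \<le> measure lborel B"
proof -
  have "row_integral B x \<le> (\<integral>y. indicator B y \<partial>lborel)"
    unfolding row_integral_def using assms emeasure_bounded_finite[where 'a = real]
    by (intro integral_mono integrable_row integrable_real_indicator)
       (auto simp: indicator_def kernel_sq_le_1)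
  thus ?thesis
    by simp
qed

lemma integrable_pair:
  assumes "A \<in> sets borel" "bounded A" "B \<in> sets borel" "bounded B"
  shows "integrable lborel (\<lambda>x. indicat_real A x * row_integral B x)"
proof (rule Bochner_Integration.integrable_bound)
  show "integrable lborel (\<lambda>x. measure lborel B * indicat_real A x)"
    using assms emeasure_bounded_finite[where 'a = real] by (auto intro!: integrable_real_indicator)
  show "(\<lambda>y. indicat_real A y * row_integral B y) \<in> borel_measurable lborel"
    using assms(1,3) by measurable
qed (use assms in \<open>auto simp: indicator_def row_integral_nonneg row_integral_le\<close>)

lemma pair_integral_nonneg: "0 \<le> pair_integral A B"
  unfolding pair_integral_def by (intro integral_nonneg_AE) (auto simp: row_integral_nonneg)

lemma pair_integral_shift:
  "pair_integral {a + t..<b + t} {c + t..<d + t} = pair_integral {a..<b} {c..<d}"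
proof -
  have row: "row_integral {c + t..<d + t} (t + x) = row_integral {c..<d} x" for x
  proof -
    have "row_integral {c + t..<d + t} (t + x)
        = (\<integral>y. indicator {c + t..<d + t} (t + y) * kernel_sq ((t + x) - (t + y)) \<partial>lborel)"
      unfolding row_integral_def by (subst lborel_integral_real_affine[where c = 1 and t = t]) simp_all
    also have "\<dots> = row_integral {c..<d} x"
      unfolding row_integral_def by (intro Bochner_Integration.integral_cong) (auto simp: indicator_def)
    finally show ?thesis .
  qed
  have "pair_integral {a + t..<b + t} {c + t..<d + t}
      = (\<integral>x. indicator {a + t..<b + t} (t + x) * row_integral {c + t..<d + t} (t + x) \<partial>lborel)"
    unfolding pair_integral_def by (subst lborel_integral_real_affine[where c = 1 and t = t]) simp_all
  also have "\<dots> = pair_integral {a..<b} {c..<d}"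
    unfolding pair_integral_def row
    by (intro Bochner_Integration.integral_cong) (auto simp: indicator_def)
  finally show ?thesis .
qed

text \<open>
  For \<open>x\<close> in the first interval and \<open>y\<close> in \<open>[2r,3r]\<close> the distance is at most \<open>4r\<close>, hence
  \<open>K(x,y)\<^sup>2 \<ge> sin\<^sup>2(\<pi>(x-y)) / (16\<pi>\<^sup>2r\<^sup>2)\<close>. The sine squared has mean \<open>1/2\<close>, and the area of integration is
  of order \<open>r\<^sup>2\<close>, so \<open>r\<close> cancels.
\<close>
lemma pair_integral_lower_bound:
  assumes "r \<ge> 1"
  shows "1 / (32 * pi\<^sup>2) \<le> pair_integral {-r..<r} {2 * r..<4 * r}"
proof -
  define c where "c = 1 / (64 * pi\<^sup>2 * r)"
  have row: "c \<le> row_integral {2 * r..<4 * r} x" if x: "x \<in> {-r..<r}" for x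
  proof -
    define F where "F y = y / 2 + sin (2 * pi * (x - y)) / (4 * pi)" for y
    have F: "(F has_real_derivative (sin (pi * (x - y)))\<^sup>2) (at y)" for y
    proof -
      have "(F has_real_derivative 1 / 2 + cos (2 * pi * (x - y)) * (2 * pi * -1) / (4 * pi)) (at y)"
        unfolding F_def[abs_def] by (rule derivative_eq_intros refl | simp)+
      also have "1 / 2 + cos (2 * pi * (x - y)) * (2 * pi * -1) / (4 * pi) = (sin (pi * (x - y)))\<^sup>2"
        using cos_double_sin[of "pi * (x - y)"] by (simp add: field_simps)
      finally show ?thesis .
    qed
    have FTC: "(\<integral>y. (sin (pi * (x - y)))\<^sup>2 * indicator {2 * r..3 * r} y \<partial>lborel) = F (3 * r) - F (2 * r)"
      "integrable lborel (\<lambda>y. (sin (pi * (x - y)))\<^sup>2 * indicat_real {2 * r..3 * r} y)"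
      using has_bochner_integral_FTC_Icc_real[of "2 * r" "3 * r" F "\<lambda>y. (sin (pi * (x - y)))\<^sup>2"] F assms
      by (auto simp: has_bochner_integral_iff)
    have "r / 4 \<le> F (3 * r) - F (2 * r)"
    proof -
      have s: "\<bar>sin t / (4 * pi)\<bar> \<le> 1 / 8" for t
      proof -
        have "\<bar>sin t\<bar> / (4 * pi) \<le> 1 / (4 * 2)"
          by (intro frac_le) (use pi_ge_two in auto)
        thus ?thesis
          by simp
      qed
      show ?thesis
        using s[of "2 * pi * (x - 3 * r)"] s[of "2 * pi * (x - 2 * r)"] assms
        unfolding F_def by linarith
    qed
    hence "1 / (16 * pi\<^sup>2 * r\<^sup>2) * (r / 4) \<le>
        1 / (16 * pi\<^sup>2 * r\<^sup>2) * (\<integral>y. (sin (pi * (x - y)))\<^sup>2 * indicator {2 * r..3 * r} y \<partial>lborel)"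
      unfolding FTC(1) by (intro mult_left_mono) auto
    also have "\<dots> = (\<integral>y. 1 / (16 * pi\<^sup>2 * r\<^sup>2) * ((sin (pi * (x - y)))\<^sup>2 * indicator {2 * r..3 * r} y) \<partial>lborel)"
      by simp
    also have "\<dots> \<le> row_integral {2 * r..<4 * r} x"
      unfolding row_integral_def
    proof (intro integral_mono integrable_row integrable_mult_right FTC(2))
      fix y
      show "1 / (16 * pi\<^sup>2 * r\<^sup>2) * ((sin (pi * (x - y)))\<^sup>2 * indicat_real {2 * r..3 * r} y)
          \<le> indicat_real {2 * r..<4 * r} y * kernel_sq (x - y)"
      proof (cases "y \<in> {2 * r..3 * r}")
        case True
        hence xy: "x - y < 0" "\<bar>x - y\<bar> \<le> 4 * r" and y: "y \<in> {2 * r..<4 * r}"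
          using x assms by auto
        have "(x - y)\<^sup>2 \<le> (4 * r)\<^sup>2"
          using power_mono[OF xy(2), of 2] by simp
        hence "pi\<^sup>2 * (x - y)\<^sup>2 \<le> 16 * pi\<^sup>2 * r\<^sup>2"
          by (simp add: power_mult_distrib)
        hence "(sin (pi * (x - y)))\<^sup>2 / (16 * pi\<^sup>2 * r\<^sup>2) \<le> (sin (pi * (x - y)))\<^sup>2 / (pi\<^sup>2 * (x - y)\<^sup>2)"
          using xy(1) assms by (intro divide_left_mono mult_pos_pos) auto
        also have "\<dots> = kernel_sq (x - y)"
          using xy(1) by (simp add: kernel_sq_def sine_kernel_def power_divide power_mult_distrib)
        finally show ?thesis
          using True y by simp
      qed (simp add: kernel_sq_nonneg)
    qed auto
    finally show ?thesis
      using assms by (simp add: c_def power2_eq_square)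
  qed
  have "1 / (32 * pi\<^sup>2) = c * (2 * r)"
    using assms by (simp add: c_def)
  also have "\<dots> = (\<integral>x. c * indicator {-r..<r} x \<partial>lborel)"
    using assms by simp
  also have "\<dots> \<le> pair_integral {-r..<r} {2 * r..<4 * r}"
    unfolding pair_integral_def
  proof (intro integral_mono integrable_pair)
    have "emeasure lborel {-r..<r} < \<infinity>"
      by (intro emeasure_bounded_finite) simp
    thus "integrable lborel (\<lambda>x. c * indicat_real {-r..<r} x)"
      by (intro integrable_mult_right integrable_real_indicator) auto
  qed (use row in \<open>auto simp: indicator_def\<close>)
  finally show ?thesis .
qed

section \<open>First and second moments of the sine process\<close>

lemma det_mat_1: "Determinant.det (Matrix.mat 1 1 f) = f (0, 0 :: nat)"
  by (subst det_single) auto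

lemma det_mat_2:
  fixes f :: "nat \<times> nat \<Rightarrow> real"
  shows "Determinant.det (Matrix.mat 2 2 f) = f (0, 0) * f (1, 1) - f (0, 1) * f (1, 0)"
proof -
  have minor: "Determinant.det (mat_delete (Matrix.mat 2 2 f) i 0) = f (1 - i, 1)" if "i < 2" for i
  proof -
    have "Determinant.det (mat_delete (Matrix.mat 2 2 f) i 0) = mat_delete (Matrix.mat 2 2 f) i 0 $$ (0, 0)"
      by (rule det_single) (simp add: mat_delete_def)
    also have "\<dots> = f (1 - i, 1)"
      using that by (cases "i = 0") (auto simp: mat_delete_def)
    finally show ?thesis .
  qed
  have "Determinant.det (Matrix.mat 2 2 f)
      = (\<Sum>i<2. Matrix.mat 2 2 f $$ (i, 0) * cofactor (Matrix.mat 2 2 f) i 0)"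
    by (rule laplace_expansion_column) auto
  also have "\<dots> = f (0, 0) * f (1, 1) - f (0, 1) * f (1, 0)"
    using minor[of 0] minor[of 1] by (simp add: numeral_2_eq_2 cofactor_def)
  finally show ?thesis .
qed

definition sine_correlation :: "nat \<Rightarrow> (nat \<Rightarrow> real) \<Rightarrow> real" where
  "sine_correlation n x = Determinant.det (Matrix.mat n n (\<lambda>(i, j). sine_kernel (x i) (x j)))"

lemma sine_factorial_moment:
  fixes m n :: nat
  assumes "sine2_law P"
    and "\<And>j. j < m \<Longrightarrow> A j \<in> sets borel" "\<And>j. j < m \<Longrightarrow> bounded (A j)"
    and "disjoint_family_on A {..<m}" "b \<in> {..<n} \<rightarrow> {..<m}"
  shows "set_integrable (PiM {..<n} (\<lambda>_. lborel)) (PiE {..<n} (\<lambda>i. A (b i))) (sine_correlation n)"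
    and "has_bochner_integral P
      (\<lambda>\<gamma>. \<Prod>j<m. falling_factorial (measure \<gamma> (A j)) (card {i \<in> {..<n}. b i = j}))
      (set_lebesgue_integral (PiM {..<n} (\<lambda>_. lborel)) (PiE {..<n} (\<lambda>i. A (b i))) (sine_correlation n))"
proof -
  have corr: "has_correlation_functions P sine_correlation"
    using assms(1) by (simp add: sine2_law_def determinantal_process_def sine_correlation_def[abs_def])
  show "set_integrable (PiM {..<n} (\<lambda>_. lborel)) (PiE {..<n} (\<lambda>i. A (b i))) (sine_correlation n)"
    and "has_bochner_integral P
      (\<lambda>\<gamma>. \<Prod>j<m. falling_factorial (measure \<gamma> (A j)) (card {i \<in> {..<n}. b i = j}))
      (set_lebesgue_integral (PiM {..<n} (\<lambda>_. lborel)) (PiE {..<n} (\<lambda>i. A (b i))) (sine_correlation n))"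
    using corr[unfolded has_correlation_functions_def, THEN spec[of _ n], THEN spec[of _ m],
        THEN spec[of _ A], THEN spec[of _ b]]
      assms(2-5) by simp_all
qed

lemma sine_correlation_1: "sine_correlation 1 x = 1"
  unfolding sine_correlation_def by (subst det_mat_1) (simp add: sine_kernel_def)

lemma sine_correlation_2: "sine_correlation 2 x = 1 - kernel_sq (x 0 - x 1)"
  unfolding sine_correlation_def by (subst det_mat_2) (simp add: sine_kernel_prod, simp add: sine_kernel_def)

lemma sine_first_moment:
  assumes "sine2_law P" "A \<in> sets borel" "bounded A"
  shows "has_bochner_integral P (\<lambda>\<gamma>. measure \<gamma> A) (measure lborel A)"
proof -
  interpret product_sigma_finite "\<lambda>_ :: nat. lborel :: real measure"
    by standard
  have "has_bochner_integral P
      (\<lambda>\<gamma>. \<Prod>j<1::nat. falling_factorial (measure \<gamma> A) (card {i \<in> {..<1::nat}. 0 = j}))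
      (set_lebesgue_integral (PiM {..<1::nat} (\<lambda>_. lborel)) (PiE {..<1} (\<lambda>i. A)) (sine_correlation 1))"
    by (rule sine_factorial_moment(2)[OF assms(1), where A = "\<lambda>_. A" and b = "\<lambda>_. 0" and m = 1])
       (use assms in \<open>auto simp: disjoint_family_on_def\<close>)
  also have "(\<lambda>\<gamma>. \<Prod>j<1::nat. falling_factorial (measure \<gamma> A) (card {i \<in> {..<1::nat}. 0 = j}))
      = (\<lambda>\<gamma>. measure \<gamma> A)"
    by (simp add: falling_factorial_def)
  also have "set_lebesgue_integral (PiM {..<1::nat} (\<lambda>_. lborel)) (PiE {..<1} (\<lambda>i. A)) (sine_correlation 1)
      = measure (PiM {..<1::nat} (\<lambda>_. lborel)) (PiE {..<1} (\<lambda>i. A))"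
    unfolding sine_correlation_1 set_lebesgue_integral_def using assms(2) by (simp add: sets_PiM_I_finite)
  also have "\<dots> = measure lborel A"
    unfolding measure_def using assms(2) by (subst emeasure_PiM) auto
  finally show ?thesis .
qed

lemma two_point_integral:
  assumes A: "A \<in> sets borel" "bounded A" and B: "B \<in> sets borel" "bounded B"
    and S: "S = PiE {..<2::nat} (\<lambda>i. if i = 0 then A else B)"
    and int: "set_integrable (PiM {..<2::nat} (\<lambda>_. lborel)) S
      (sine_correlation 2)"
  shows "set_lebesgue_integral (PiM {..<2::nat} (\<lambda>_. lborel)) S
      (sine_correlation 2)
    = measure lborel A * measure lborel B - pair_integral A B"
proof -
  interpret product_sigma_finite "\<lambda>_ :: nat. lborel :: real measure"
    by standard
  define G where "G x y = indicat_real A x * (indicat_real B y * (1 - kernel_sq (x - y)))" for x y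
  have two: "{..<2::nat} = insert 1 {0}"
    by auto
  have G: "indicat_real S x * (1 - kernel_sq (x 0 - x (Suc 0))) = G (x 0) (x (Suc 0))"
    if "x \<in> space (PiM {..<2::nat} (\<lambda>_. lborel))" for x
  proof -
    have "x \<in> S \<longleftrightarrow> x 0 \<in> A \<and> x 1 \<in> B"
      using that by (auto simp: S space_PiM PiE_iff two)
    thus ?thesis
      by (simp add: G_def indicator_def)
  qed
  have int': "integrable (PiM (insert 1 {0::nat}) (\<lambda>_. lborel)) (\<lambda>x. G (x 0) (x 1))"
    using int unfolding set_integrable_def sine_correlation_2 two[symmetric]
    by (rule Bochner_Integration.integrable_cong[THEN iffD1, rotated 2]) (simp_all add: G)
  have inner: "(\<integral>y. G x y \<partial>lborel) = indicat_real A x * (measure lborel B - row_integral B x)" for x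
  proof -
    have "(\<integral>y. indicat_real B y * (1 - kernel_sq (x - y)) \<partial>lborel)
        = (\<integral>y. indicat_real B y - indicat_real B y * kernel_sq (x - y) \<partial>lborel)"
      by (simp add: right_diff_distrib)
    also have "\<dots> = measure lborel B - row_integral B x"
      using B emeasure_bounded_finite[where 'a = real]
      by (subst Bochner_Integration.integral_diff)
         (auto intro!: integrable_row integrable_real_indicator simp: row_integral_def)
    finally show ?thesis
      by (simp add: G_def)
  qed
  have "set_lebesgue_integral (PiM {..<2::nat} (\<lambda>_. lborel)) S
      (sine_correlation 2)
    = (\<integral>x. G (x 0) (x 1) \<partial>PiM (insert 1 {0::nat}) (\<lambda>_. lborel))"
    unfolding set_lebesgue_integral_def sine_correlation_2 two[symmetric]
    by (rule Bochner_Integration.integral_cong) (simp_all add: G)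
  also have "\<dots> = (\<integral>x. (\<integral>y. G (x 0) y \<partial>lborel) \<partial>PiM {0::nat} (\<lambda>_. lborel))"
    by (subst product_integral_insert[OF _ _ int']) simp_all
  also have "\<dots> = (\<integral>x. indicat_real A (x 0) * (measure lborel B - row_integral B (x 0)) \<partial>PiM {0::nat} (\<lambda>_. lborel))"
    unfolding inner ..
  also have "\<dots> = (\<integral>x. indicat_real A x * (measure lborel B - row_integral B x) \<partial>lborel)"
    using A(1) borel_measurable_row[OF B(1)]
    by (intro product_integral_singleton borel_measurable_times borel_measurable_diff) auto
  also have "\<dots> = (\<integral>x. measure lborel B * indicat_real A x - indicat_real A x * row_integral B x \<partial>lborel)"
    by (intro Bochner_Integration.integral_cong) (auto simp: algebra_simps)
  also have "\<dots> = measure lborel A * measure lborel B - pair_integral A B"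
    using A B emeasure_bounded_finite[where 'a = real]
    by (subst Bochner_Integration.integral_diff)
       (auto intro!: integrable_pair integrable_real_indicator simp: pair_integral_def)
  finally show ?thesis .
qed

lemma sine_second_moment_disjoint:
  assumes "sine2_law P" and A: "A \<in> sets borel" "bounded A" and B: "B \<in> sets borel" "bounded B"
    and "A \<inter> B = {}"
  shows "has_bochner_integral P (\<lambda>\<gamma>. measure \<gamma> A * measure \<gamma> B)
    (measure lborel A * measure lborel B - pair_integral A B)"
proof -
  define C where "C i = (if i = (0::nat) then A else B)" for i
  let ?M = "PiM {..<2::nat} (\<lambda>_. lborel :: real measure)" and ?S = "PiE {..<2::nat} C"
  have int: "set_integrable ?M ?S (sine_correlation 2)"
    and moment: "has_bochner_integral P
      (\<lambda>\<gamma>. \<Prod>j<2. falling_factorial (measure \<gamma> (C j)) (card {i \<in> {..<2::nat}. i = j}))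
      (set_lebesgue_integral ?M ?S (sine_correlation 2))"
    by (rule sine_factorial_moment[OF assms(1), where A = C and b = "\<lambda>i. i" and m = 2];
        use A B assms(6) in \<open>auto simp: disjoint_family_on_def C_def\<close>)+
  have "set_lebesgue_integral ?M ?S (sine_correlation 2) = measure lborel A * measure lborel B - pair_integral A B"
    by (rule two_point_integral[OF A B _ int]) (simp add: C_def[abs_def])
  moreover have "{i \<in> {..<2::nat}. i = j} = {j}" if "j < 2" for j
    using that by auto
  hence "(\<lambda>\<gamma>. \<Prod>j<2. falling_factorial (measure \<gamma> (C j)) (card {i \<in> {..<2::nat}. i = j}))
      = (\<lambda>\<gamma>. measure \<gamma> A * measure \<gamma> B)"
    by (simp add: numeral_2_eq_2 falling_factorial_def C_def)
  ultimately show ?thesis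
    using moment by simp
qed

text \<open>The factorial moment \<open>\<gamma>(A) (\<gamma>(A) - 1)\<close> plus the first moment.\<close>
lemma sine_second_moment_self:
  assumes "sine2_law P" and A: "A \<in> sets borel" "bounded A"
  shows "has_bochner_integral P (\<lambda>\<gamma>. (measure \<gamma> A)\<^sup>2)
    ((measure lborel A)\<^sup>2 + measure lborel A - pair_integral A A)"
proof -
  let ?M = "PiM {..<2::nat} (\<lambda>_. lborel :: real measure)" and ?S = "PiE {..<2::nat} (\<lambda>_. A)"
  have int: "set_integrable ?M ?S (sine_correlation 2)"
    and moment: "has_bochner_integral P
      (\<lambda>\<gamma>. \<Prod>j<1::nat. falling_factorial (measure \<gamma> A) (card {i \<in> {..<2::nat}. 0 = j}))
      (set_lebesgue_integral ?M ?S (sine_correlation 2))"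
    by (rule sine_factorial_moment[OF assms(1), where A = "\<lambda>_. A" and b = "\<lambda>_. 0" and m = 1];
        use A in \<open>auto simp: disjoint_family_on_def\<close>)+
  have "set_lebesgue_integral ?M ?S (sine_correlation 2) = measure lborel A * measure lborel A - pair_integral A A"
    by (rule two_point_integral[OF A A _ int]) simp
  moreover have "(\<lambda>\<gamma>. \<Prod>j<1::nat. falling_factorial (measure \<gamma> A) (card {i \<in> {..<2::nat}. 0 = j}))
      = (\<lambda>\<gamma>. measure \<gamma> A * (measure \<gamma> A - 1))"
    by (simp add: falling_factorial_def numeral_2_eq_2)
  ultimately have "has_bochner_integral P (\<lambda>\<gamma>. measure \<gamma> A * (measure \<gamma> A - 1) + measure \<gamma> A)
      (measure lborel A * measure lborel A - pair_integral A A + measure lborel A)"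
    using moment sine_first_moment[OF assms] by (intro has_bochner_integral_add) simp_all
  thus ?thesis
    by (simp add: power2_eq_square algebra_simps)
qed

section \<open>Quadratic forms with nonpositive off-diagonal entries\<close>

lemma sum_le_sum_subset:
  fixes f :: "'a \<Rightarrow> real"
  assumes "finite T" "S \<subseteq> T" "\<And>x. x \<in> T - S \<Longrightarrow> f x \<le> 0"
  shows "sum f T \<le> sum f S"
  using sum_mono2[OF assms(1,2), of "\<lambda>x. - f x"] assms(3) by (simp add: sum_negf)

text \<open>
  In the section of the Toeplitz matrix of size \<open>N = M + 2L\<close>, the \<open>M\<close> inner rows contain the whole
  window \<open>{-L..L}\<close> and otherwise only nonpositive entries; each of the remaining \<open>2L\<close> rows has sum
  at most \<open>a 0\<close>. If the window had a negative sum, the total would be negative for large \<open>M\<close>.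
\<close>
lemma toeplitz_window_nonneg:
  fixes a :: "int \<Rightarrow> real"
  assumes neg: "\<And>d. d \<noteq> 0 \<Longrightarrow> a d \<le> 0"
    and pos: "\<And>N. 0 \<le> (\<Sum>j\<in>{0..<N}. \<Sum>k\<in>{0..<N}. a (k - j))"
    and "0 \<le> L"
  shows "0 \<le> (\<Sum>d\<in>{-L..L}. a d)"
proof (rule ccontr)
  define r where "r = (\<Sum>d\<in>{-L..L}. a d)"
  assume "\<not> 0 \<le> (\<Sum>d\<in>{-L..L}. a d)"
  hence r: "r < 0"
    by (simp add: r_def)
  obtain M :: nat where M: "2 * L * a 0 < M * (- r)"
    using reals_Archimedean3[of "- r"] r by auto
  define N where "N = int M + 2 * L"
  define row where "row j = (\<Sum>k\<in>{0..<N}. a (k - j))" for j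
  have inner: "row j \<le> r" if "j \<in> {L..<L + int M}" for j
  proof -
    have "row j \<le> (\<Sum>k\<in>{j - L..j + L}. a (k - j))"
      unfolding row_def using that assms(3) by (intro sum_le_sum_subset neg) (auto simp: N_def)
    also have "\<dots> = r"
      unfolding r_def by (rule sum.reindex_bij_witness[of _ "\<lambda>d. d + j" "\<lambda>k. k - j"]) auto
    finally show ?thesis .
  qed
  have outer: "row j \<le> a 0" if "j \<in> {0..<N}" for j
  proof -
    have "row j \<le> (\<Sum>k\<in>{j}. a (k - j))"
      unfolding row_def using that by (intro sum_le_sum_subset neg) auto
    thus ?thesis
      by simp
  qed
  have card: "card ({0..<N} - {L..<L + int M}) = nat (2 * L)"
    using assms(3) by (subst card_Diff_subset) (auto simp: N_def)
  have "0 \<le> (\<Sum>j\<in>{0..<N}. row j)"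
    unfolding row_def by (rule pos)
  also have "\<dots> = (\<Sum>j\<in>{0..<N} - {L..<L + int M}. row j) + (\<Sum>j\<in>{L..<L + int M}. row j)"
    using assms(3) by (intro sum.subset_diff) (auto simp: N_def)
  also have "\<dots> \<le> real (card ({0..<N} - {L..<L + int M})) * a 0 + real (card {L..<L + int M}) * r"
    by (intro add_mono sum_bounded_above inner outer) auto
  also have "\<dots> = 2 * L * a 0 + M * r"
    unfolding card using assms(3) by simp
  finally show False
    using M by simp
qed

text \<open>
  From \<open>2 c\<^sub>j c\<^sub>k = c\<^sub>j\<^sup>2 + c\<^sub>k\<^sup>2 - (c\<^sub>j - c\<^sub>k)\<^sup>2\<close>: the square terms collect into row sums, which are
  nonnegative, and each difference term contributes a nonnegative amount.
\<close>
lemma quadratic_form_lower_bound: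
  fixes C :: "'i \<Rightarrow> 'i \<Rightarrow> real"
  assumes "finite S" and sym: "\<And>j k. C j k = C k j"
    and off: "\<And>j k. j \<noteq> k \<Longrightarrow> C j k \<le> 0"
    and row: "\<And>j. j \<in> S \<Longrightarrow> 0 \<le> (\<Sum>k\<in>S. C j k)"
    and "J \<subseteq> S" "K \<subseteq> S" "J \<inter> K = {}" "0 \<le> m"
    and J: "\<And>j. j \<in> J \<Longrightarrow> m \<le> c j" and K: "\<And>k. k \<in> K \<Longrightarrow> c k = 0"
  shows "m\<^sup>2 / 2 * (\<Sum>j\<in>J. \<Sum>k\<in>K. - C j k) \<le> (\<Sum>j\<in>S. \<Sum>k\<in>S. c j * c k * C j k)"
proof -
  define f where "f j k = (c j - c k)\<^sup>2 / 2 * (- C j k)" for j k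
  have f_nonneg: "0 \<le> f j k" for j k
  proof (cases "j = k")
    case False
    from off[OF this] show ?thesis
      unfolding f_def by (intro mult_nonneg_nonneg) auto
  qed (simp add: f_def)
  have "m\<^sup>2 / 2 * (\<Sum>j\<in>J. \<Sum>k\<in>K. - C j k) = (\<Sum>j\<in>J. \<Sum>k\<in>K. m\<^sup>2 / 2 * (- C j k))"
    by (simp add: sum_distrib_left)
  also have "\<dots> \<le> (\<Sum>j\<in>J. \<Sum>k\<in>K. f j k)"
  proof (intro sum_mono)
    fix j k assume jk: "j \<in> J" "k \<in> K"
    hence "j \<noteq> k"
      using assms(7) by blast
    have "m\<^sup>2 \<le> (c j - c k)\<^sup>2"
      using J[OF jk(1)] K[OF jk(2)] assms(8) by (simp add: power_mono)
    thus "m\<^sup>2 / 2 * (- C j k) \<le> f j k"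
      unfolding f_def using off[OF \<open>j \<noteq> k\<close>] by (intro mult_right_mono) auto
  qed
  also have "\<dots> = (\<Sum>(j, k)\<in>J \<times> K. f j k)"
    by (rule sum.cartesian_product)
  also have "\<dots> \<le> (\<Sum>(j, k)\<in>S \<times> S. f j k)"
    using assms(1,5,6) f_nonneg by (intro sum_mono2) auto
  also have "\<dots> = (\<Sum>j\<in>S. \<Sum>k\<in>S. f j k)"
    by (rule sum.cartesian_product[symmetric])
  also have "\<dots> \<le> (\<Sum>j\<in>S. (c j)\<^sup>2 * (\<Sum>k\<in>S. C j k)) + (\<Sum>j\<in>S. \<Sum>k\<in>S. f j k)"
    using row by (simp add: sum_nonneg)
  also have "(\<Sum>j\<in>S. (c j)\<^sup>2 * (\<Sum>k\<in>S. C j k)) = (\<Sum>j\<in>S. \<Sum>k\<in>S. ((c j)\<^sup>2 + (c k)\<^sup>2) / 2 * C j k)"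
  proof -
    have "(\<Sum>j\<in>S. \<Sum>k\<in>S. (c k)\<^sup>2 * C j k) = (\<Sum>k\<in>S. \<Sum>j\<in>S. (c k)\<^sup>2 * C k j)"
      by (subst sum.swap) (simp add: sym)
    hence "(\<Sum>j\<in>S. \<Sum>k\<in>S. (c j)\<^sup>2 * C j k)
        = ((\<Sum>j\<in>S. \<Sum>k\<in>S. (c j)\<^sup>2 * C j k) + (\<Sum>j\<in>S. \<Sum>k\<in>S. (c k)\<^sup>2 * C j k)) / 2"
      by simp
    also have "\<dots> = (\<Sum>j\<in>S. \<Sum>k\<in>S. ((c j)\<^sup>2 + (c k)\<^sup>2) / 2 * C j k)"
      by (simp add: sum.distrib[symmetric] sum_divide_distrib algebra_simps)
    finally show ?thesis
      by (simp add: sum_distrib_left)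
  qed
  also have "\<dots> + (\<Sum>j\<in>S. \<Sum>k\<in>S. f j k) = (\<Sum>j\<in>S. \<Sum>k\<in>S. ((c j)\<^sup>2 + (c k)\<^sup>2) / 2 * C j k + f j k)"
    by (simp only: sum.distrib)
  also have "\<dots> = (\<Sum>j\<in>S. \<Sum>k\<in>S. c j * c k * C j k)"
    by (intro sum.cong refl) (simp add: f_def power2_eq_square field_simps)
  finally show ?thesis .
qed

section \<open>Covariances of counts\<close>

lemma sine_prob_space: "sine2_law P \<Longrightarrow> prob_space P"
  by (simp add: sine2_law_def determinantal_process_def)

lemma sine_space:
  assumes "sine2_law P"
  shows "space P = configurations"
proof -
  have "space P = space configuration_algebra"
    using assms by (intro sets_eq_imp_space_eq) (simp add: sine2_law_def determinantal_process_def)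
  thus ?thesis
    by (auto simp: configuration_algebra_def space_Sup_eq_UN)
qed

lemma sets_configuration: "\<gamma> \<in> configurations \<Longrightarrow> sets \<gamma> = sets borel"
  by (auto simp: configurations_def)

lemma configuration_finite:
  assumes "\<gamma> \<in> configurations" "bounded A" "A \<in> sets borel"
  shows "emeasure \<gamma> A < \<infinity>"
proof -
  obtain I x where \<gamma>: "\<gamma> = config I x" and lf: "locally_finite I x"
    using assms(1) configurations_iff by blast
  have "finite {i \<in> I. x i \<in> closure A}"
    using lf assms(2) unfolding locally_finite_def by (simp add: compact_closure)
  hence fin: "finite (x -` A \<inter> I)"
    by (rule rev_finite_subset) (use closure_subset in auto)
  have "emeasure \<gamma> A = emeasure (count_space I) (x -` A \<inter> space (count_space I))"
    unfolding \<gamma> config_def using assms(3) by (intro emeasure_distr) auto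
  also have "\<dots> < \<infinity>"
    using fin by (simp add: emeasure_count_space of_nat_less_top)
  finally show ?thesis .
qed

lemma Var_nonneg:
  assumes "prob_space P" "integrable P X" "integrable P (\<lambda>x. (X x)\<^sup>2)"
  shows "0 \<le> Var P X"
proof -
  interpret prob_space P by fact
  show ?thesis
    using variance_eq[OF assms(2,3)] variance_positive[of X] by (simp add: Var_def)
qed

lemma Var_tendsto:
  fixes Y :: "nat \<Rightarrow> 'a \<Rightarrow> real"
  assumes "prob_space P" "X \<in> borel_measurable P" "\<And>n. Y n \<in> borel_measurable P"
    and lim: "\<And>\<omega>. \<omega> \<in> space P \<Longrightarrow> (\<lambda>n. Y n \<omega>) \<longlonglongrightarrow> X \<omega>"
    and bound: "\<And>n \<omega>. \<omega> \<in> space P \<Longrightarrow> \<bar>Y n \<omega>\<bar> \<le> Z \<omega>"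
    and Z: "integrable P Z" "integrable P (\<lambda>\<omega>. (Z \<omega>)\<^sup>2)"
  shows "(\<lambda>n. Var P (Y n)) \<longlonglongrightarrow> Var P X"
  unfolding Var_def
proof (intro tendsto_diff tendsto_power)
  show "(\<lambda>n. \<integral>x. Y n x \<partial>P) \<longlonglongrightarrow> (\<integral>x. X x \<partial>P)"
    by (rule integral_dominated_convergence[where w = Z]) (use assms in auto)
  show "(\<lambda>n. \<integral>x. (Y n x)\<^sup>2 \<partial>P) \<longlonglongrightarrow> (\<integral>x. (X x)\<^sup>2 \<partial>P)"
  proof (rule integral_dominated_convergence[where w = "\<lambda>\<omega>. (Z \<omega>)\<^sup>2"])
    show "AE x in P. (\<lambda>n. (Y n x)\<^sup>2) \<longlonglongrightarrow> (X x)\<^sup>2"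
      using lim by (auto intro!: tendsto_power)
    show "AE x in P. norm ((Y n x)\<^sup>2) \<le> (Z x)\<^sup>2" for n
      using power_mono[OF bound abs_ge_zero, of _ n 2] by auto
  qed (use assms in auto)
qed

text \<open>The covariance of \<open>\<gamma>(A)\<close> and \<open>\<gamma>(B)\<close>, since the intensity of the process is Lebesgue measure.\<close>
definition count_cov :: "real measure measure \<Rightarrow> real set \<Rightarrow> real set \<Rightarrow> real" where
  "count_cov P A B = (\<integral>\<gamma>. measure \<gamma> A * measure \<gamma> B \<partial>P) - measure lborel A * measure lborel B"

lemma count_cov_commute: "count_cov P A B = count_cov P B A"
  by (simp add: count_cov_def mult.commute)

lemma count_cov_disjoint:
  assumes "sine2_law P" "A \<in> sets borel" "bounded A" "B \<in> sets borel" "bounded B" "A \<inter> B = {}"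
  shows "count_cov P A B = - pair_integral A B"
  using has_bochner_integral_integral_eq[OF sine_second_moment_disjoint[OF assms]]
  by (simp add: count_cov_def)

lemma count_cov_self:
  assumes "sine2_law P" "A \<in> sets borel" "bounded A"
  shows "count_cov P A A = measure lborel A - pair_integral A A"
  using has_bochner_integral_integral_eq[OF sine_second_moment_self[OF assms]]
  by (simp add: count_cov_def power2_eq_square)

lemma integrable_count:
  assumes "sine2_law P" "A \<in> sets borel" "bounded A"
  shows "integrable P (\<lambda>\<gamma>. measure \<gamma> A)" "(\<integral>\<gamma>. measure \<gamma> A \<partial>P) = measure lborel A"
    "integrable P (\<lambda>\<gamma>. (measure \<gamma> A)\<^sup>2)"
  using sine_first_moment[OF assms] sine_second_moment_self[OF assms]
  by (auto simp: has_bochner_integral_iff)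

lemma integrable_count_product:
  assumes "sine2_law P" "A \<in> sets borel" "bounded A" "B \<in> sets borel" "bounded B"
  shows "integrable P (\<lambda>\<gamma>. measure \<gamma> A * measure \<gamma> B)"
proof (rule Bochner_Integration.integrable_bound)
  show "integrable P (\<lambda>\<gamma>. (measure \<gamma> A)\<^sup>2 + (measure \<gamma> B)\<^sup>2)"
    using assms by (intro Bochner_Integration.integrable_add integrable_count)
  show "(\<lambda>\<gamma>. measure \<gamma> A * measure \<gamma> B) \<in> borel_measurable P"
    using assms by (intro borel_measurable_times borel_measurable_integrable integrable_count)
  have "\<bar>a * b\<bar> \<le> a\<^sup>2 + b\<^sup>2" for a b :: real
  proof -
    have "2 * (\<bar>a\<bar> * \<bar>b\<bar>) \<le> \<bar>a\<bar>\<^sup>2 + \<bar>b\<bar>\<^sup>2" "0 \<le> \<bar>a\<bar> * \<bar>b\<bar>"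
      using sum_squares_bound[of "\<bar>a\<bar>" "\<bar>b\<bar>"] by (simp_all add: mult.assoc)
    thus ?thesis
      unfolding abs_mult power2_abs by linarith
  qed
  from order.trans[OF this abs_ge_self]
  show "AE \<gamma> in P. norm (measure \<gamma> A * measure \<gamma> B) \<le> norm ((measure \<gamma> A)\<^sup>2 + (measure \<gamma> B)\<^sup>2)"
    by (intro AE_I2) (simp only: real_norm_def)
qed

lemma step_stat_moments:
  fixes c :: "'i \<Rightarrow> real" and A :: "'i \<Rightarrow> real set"
  assumes "sine2_law P" "finite S"
    and A: "\<And>j. j \<in> S \<Longrightarrow> A j \<in> sets borel" "\<And>j. j \<in> S \<Longrightarrow> bounded (A j)"
  defines "X \<equiv> \<lambda>\<gamma>. \<Sum>j\<in>S. c j * measure \<gamma> (A j)"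
  shows "integrable P X" "integrable P (\<lambda>\<gamma>. (X \<gamma>)\<^sup>2)"
    "Var P X = (\<Sum>j\<in>S. \<Sum>k\<in>S. c j * c k * count_cov P (A j) (A k))"
proof -
  show "integrable P X"
    unfolding X_def using assms(1) A
    by (intro Bochner_Integration.integrable_sum integrable_mult_right integrable_count)
  have EX: "(\<integral>\<gamma>. X \<gamma> \<partial>P) = (\<Sum>j\<in>S. c j * measure lborel (A j))"
    unfolding X_def
    by (subst Bochner_Integration.integral_sum)
       (use assms(1) A in \<open>auto simp: integrable_count intro!: integrable_mult_right\<close>)
  have sq: "(X \<gamma>)\<^sup>2 = (\<Sum>j\<in>S. \<Sum>k\<in>S. c j * c k * (measure \<gamma> (A j) * measure \<gamma> (A k)))" for \<gamma>
    unfolding X_def power2_eq_square sum_product by (intro sum.cong refl) (simp only: mult_ac)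
  have int: "integrable P (\<lambda>\<gamma>. c j * c k * (measure \<gamma> (A j) * measure \<gamma> (A k)))"
    if "j \<in> S" "k \<in> S" for j k
    using assms(1) A that by (intro integrable_mult_right integrable_count_product)
  show "integrable P (\<lambda>\<gamma>. (X \<gamma>)\<^sup>2)"
    unfolding sq by (intro Bochner_Integration.integrable_sum int)
  have "(\<integral>\<gamma>. (X \<gamma>)\<^sup>2 \<partial>P)
      = (\<Sum>j\<in>S. \<Sum>k\<in>S. c j * c k * (\<integral>\<gamma>. measure \<gamma> (A j) * measure \<gamma> (A k) \<partial>P))"
    unfolding sq using int by (simp add: Bochner_Integration.integral_sum Bochner_Integration.integrable_sum)
  moreover have "(\<integral>\<gamma>. X \<gamma> \<partial>P)\<^sup>2
      = (\<Sum>j\<in>S. \<Sum>k\<in>S. c j * c k * (measure lborel (A j) * measure lborel (A k)))"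
    unfolding EX power2_eq_square sum_product by (intro sum.cong refl) (simp only: mult_ac)
  ultimately show "Var P X = (\<Sum>j\<in>S. \<Sum>k\<in>S. c j * c k * count_cov P (A j) (A k))"
    unfolding Var_def count_cov_def by (simp add: sum_subtractf right_diff_distrib)
qed

definition cell :: "nat \<Rightarrow> int \<Rightarrow> real set" where
  "cell n j = {j / n..<(j + 1) / n}"

lemma cell_sets [simp]: "cell n j \<in> sets borel" "bounded (cell n j)"
  by (auto simp: cell_def)

lemma mem_cell_iff: "n > 0 \<Longrightarrow> x \<in> cell n j \<longleftrightarrow> \<lfloor>x * n\<rfloor> = j"
  by (auto simp: cell_def floor_eq_iff field_simps)

lemma disjoint_cells:
  assumes "n > 0" "i \<noteq> j"
  shows "cell n i \<inter> cell n j = {}"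
  using assms by (auto simp: mem_cell_iff)

lemma Union_cells:
  assumes "n > 0"
  shows "(\<Union>j\<in>{p * int n..<q * int n}. cell n j) = {real_of_int p..<real_of_int q}"
proof -
  have "p * int n \<le> \<lfloor>x * n\<rfloor> \<longleftrightarrow> p \<le> x" "\<lfloor>x * n\<rfloor> < q * int n \<longleftrightarrow> x < q" for x :: real
    using assms by (simp_all add: le_floor_iff floor_less_iff)
  thus ?thesis
    using assms by (auto simp: mem_cell_iff)
qed

lemma pair_integral_cell_shift:
  "pair_integral (cell n (i + t)) (cell n (j + t)) = pair_integral (cell n i) (cell n j)"
proof -
  have "cell n (k + t) = {k / n + t / n..<(k + 1) / n + t / n}" for k
    by (simp add: cell_def add_divide_distrib algebra_simps)
  thus ?thesis
    by (simp only: pair_integral_shift cell_def)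
qed

lemma count_cov_cells:
  assumes "sine2_law P" "n > 0"
  shows "count_cov P (cell n j) (cell n k) = count_cov P (cell n 0) (cell n (k - j))"
proof (cases "j = k")
  case True
  have "measure lborel (cell n j) = measure lborel (cell n 0)"
    by (simp add: cell_def divide_right_mono add_divide_distrib)
  thus ?thesis
    using True pair_integral_cell_shift[of n 0 j 0] by (simp add: count_cov_self assms(1))
next
  case False
  thus ?thesis
    using assms pair_integral_cell_shift[of n 0 j "k - j"]
    by (subst (1 2) count_cov_disjoint) (auto intro!: disjoint_cells)
qed

lemma count_cov_cells_nonpos:
  assumes "sine2_law P" "n > 0" "j \<noteq> k"
  shows "count_cov P (cell n j) (cell n k) \<le> 0"
  using assms by (simp add: count_cov_disjoint disjoint_cells pair_integral_nonneg)

text \<open>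
  Only differences of indices in \<open>{-2M..2M}\<close> occur in the row, and extending the row to all of these
  adds nonpositive entries.
\<close>
lemma count_cov_row_nonneg:
  assumes P: "sine2_law P" and n: "n > 0" and j: "j \<in> {-M..<M}"
  shows "0 \<le> (\<Sum>k\<in>{-M..<M}. count_cov P (cell n j) (cell n k))"
proof -
  define a where "a d = count_cov P (cell n 0) (cell n d)" for d
  have a: "count_cov P (cell n j) (cell n k) = a (k - j)" for j k
    unfolding a_def by (rule count_cov_cells[OF P n])
  have neg: "a d \<le> 0" if "d \<noteq> 0" for d
    unfolding a_def using count_cov_cells_nonpos[OF P n] that by metis
  have "0 \<le> (\<Sum>d\<in>{-(2 * M)..2 * M}. a d)"
  proof (rule toeplitz_window_nonneg[OF neg])
    fix N :: int
    let ?X = "\<lambda>\<gamma>. \<Sum>j\<in>{0..<N}. 1 * measure \<gamma> (cell n j)"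
    have "0 \<le> Var P ?X"
      by (intro Var_nonneg sine_prob_space step_stat_moments P) auto
    also have "\<dots> = (\<Sum>j\<in>{0..<N}. \<Sum>k\<in>{0..<N}. a (k - j))"
      by (subst step_stat_moments(3)[OF P]) (auto simp: a)
    finally show "0 \<le> (\<Sum>j\<in>{0..<N}. \<Sum>k\<in>{0..<N}. a (k - j))" .
  qed (use j in auto)
  also have "\<dots> \<le> (\<Sum>d\<in>(\<lambda>k. k - j) ` {-M..<M}. a d)"
    using j by (intro sum_le_sum_subset neg) (auto simp: image_iff)
  also have "\<dots> = (\<Sum>k\<in>{-M..<M}. count_cov P (cell n j) (cell n k))"
    by (subst sum.reindex) (auto simp: inj_on_def a)
  finally show ?thesis .
qed

lemma sum_count_cells:
  assumes "\<gamma> \<in> configurations" "n > 0"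
  shows "(\<Sum>j\<in>{p * int n..<q * int n}. measure \<gamma> (cell n j)) = measure \<gamma> {real_of_int p..<real_of_int q}"
proof -
  have "measure \<gamma> (\<Union>j\<in>{p * int n..<q * int n}. cell n j) = (\<Sum>j\<in>{p * int n..<q * int n}. measure \<gamma> (cell n j))"
    using configuration_finite[OF assms(1)] disjoint_cells[OF assms(2)] sets_configuration[OF assms(1)]
    by (intro measure_finite_Union) (auto simp: disjoint_family_on_def less_top[symmetric])
  thus ?thesis
    by (simp add: Union_cells[OF assms(2)])
qed

text \<open>
  Bilinearity of the covariance replaces the additivity of the double integral over unions of
  cells.
\<close>
lemma count_cov_cells_sum:
  assumes P: "sine2_law P" and n: "n > 0" and "q \<le> p'"
  shows "(\<Sum>j\<in>{p * int n..<q * int n}. \<Sum>k\<in>{p' * int n..<q' * int n}. - count_cov P (cell n j) (cell n k))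
    = pair_integral {real_of_int p..<real_of_int q} {real_of_int p'..<real_of_int q'}"
proof -
  let ?J = "{p * int n..<q * int n}" and ?K = "{p' * int n..<q' * int n}"
  let ?A = "{real_of_int p..<real_of_int q}" and ?B = "{real_of_int p'..<real_of_int q'}"
  have vol: "(\<Sum>j\<in>{p * int n..<q * int n}. measure lborel (cell n j))
      = measure lborel {real_of_int p..<real_of_int q}" for p q
  proof -
    have "measure lborel (\<Union>j\<in>{p * int n..<q * int n}. cell n j)
        = (\<Sum>j\<in>{p * int n..<q * int n}. measure lborel (cell n j))"
      using emeasure_bounded_finite[where 'a = real] disjoint_cells[OF n]
      by (intro measure_finite_Union) (auto simp: disjoint_family_on_def less_top[symmetric])
    thus ?thesis
      by (simp add: Union_cells[OF n])
  qed
  have "(\<Sum>j\<in>?J. \<Sum>k\<in>?K. \<integral>\<gamma>. measure \<gamma> (cell n j) * measure \<gamma> (cell n k) \<partial>P)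
      = (\<integral>\<gamma>. (\<Sum>j\<in>?J. \<Sum>k\<in>?K. measure \<gamma> (cell n j) * measure \<gamma> (cell n k)) \<partial>P)"
    using integrable_count_product[OF P]
    by (simp add: Bochner_Integration.integral_sum Bochner_Integration.integrable_sum)
  also have "\<dots> = (\<integral>\<gamma>. measure \<gamma> ?A * measure \<gamma> ?B \<partial>P)"
    using sum_count_cells[OF _ n] sine_space[OF P]
    by (intro Bochner_Integration.integral_cong refl) (simp add: sum_product[symmetric])
  finally have "(\<Sum>j\<in>?J. \<Sum>k\<in>?K. count_cov P (cell n j) (cell n k)) = count_cov P ?A ?B"
    unfolding count_cov_def by (simp add: sum_subtractf sum_product[symmetric] vol)
  also have "\<dots> = - pair_integral ?A ?B"
    using assms(3) by (intro count_cov_disjoint[OF P]) auto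
  finally show ?thesis
    by (simp add: sum_negf)
qed

lemma step_stat_variance_lower_bound:
  assumes P: "sine2_law P" and n: "n > 0" and r: "r \<ge> (1::nat)" and "0 \<le> m"
    and u: "\<And>x. \<bar>x\<bar> \<le> r \<Longrightarrow> m \<le> u x" "\<And>x. \<bar>x\<bar> \<ge> 2 * r \<Longrightarrow> u x = 0"
  shows "m\<^sup>2 / (64 * pi\<^sup>2)
    \<le> Var P (\<lambda>\<gamma>. \<Sum>j\<in>{- (4 * int r * int n)..<4 * int r * int n}. u (j / n) * measure \<gamma> (cell n j))"
proof -
  let ?S = "{- (4 * int r * int n)..<4 * int r * int n}"
  let ?J = "{(- int r) * int n..<int r * int n}" and ?K = "{2 * int r * int n..<4 * int r * int n}"
  have "m\<^sup>2 / (64 * pi\<^sup>2) = m\<^sup>2 / 2 * (1 / (32 * pi\<^sup>2))"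
    by simp
  also have "\<dots> \<le> m\<^sup>2 / 2 * pair_integral {-real r..<real r} {2 * real r..<4 * real r}"
    using r by (intro mult_left_mono pair_integral_lower_bound) auto
  also have "pair_integral {-real r..<real r} {2 * real r..<4 * real r}
      = (\<Sum>j\<in>?J. \<Sum>k\<in>?K. - count_cov P (cell n j) (cell n k))"
    using count_cov_cells_sum[OF P n, where p = "- int r" and q = "int r" and p' = "2 * int r"
        and q' = "4 * int r"] by simp
  also have "m\<^sup>2 / 2 * \<dots> \<le> (\<Sum>j\<in>?S. \<Sum>k\<in>?S. u (j / n) * u (k / n) * count_cov P (cell n j) (cell n k))"
  proof (rule quadratic_form_lower_bound)
    show "count_cov P (cell n j) (cell n k) = count_cov P (cell n k) (cell n j)" for j k
      by (rule count_cov_commute)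
    show "count_cov P (cell n j) (cell n k) \<le> 0" if "j \<noteq> k" for j k
      by (rule count_cov_cells_nonpos[OF P n that])
    show "0 \<le> (\<Sum>k\<in>?S. count_cov P (cell n j) (cell n k))" if "j \<in> ?S" for j
      using that by (rule count_cov_row_nonneg[OF P n])
    have mono: "a * int r * int n \<le> b * int r * int n" if "a \<le> b" for a b
      using that by (intro mult_right_mono) auto
    show "?J \<subseteq> ?S" "?K \<subseteq> ?S" "?J \<inter> ?K = {}"
      using mono[of 1 4] mono[of "-4" "-1"] mono[of "-4" 2] mono[of 1 2] by auto
    show "m \<le> u (j / n)" if "j \<in> ?J" for j
    proof (rule u(1))
      have "\<bar>real_of_int j\<bar> \<le> real_of_int (int r * int n)"
        using that by (auto simp del: of_int_mult)
      thus "\<bar>j / n\<bar> \<le> r"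
        using n by (simp add: divide_le_eq)
    qed
    show "u (k / n) = 0" if "k \<in> ?K" for k
    proof (rule u(2))
      have "real_of_int (2 * int r * int n) \<le> \<bar>real_of_int k\<bar>"
        using that by (auto simp del: of_int_mult)
      thus "\<bar>k / n\<bar> \<ge> 2 * r"
        using n by (simp add: le_divide_eq)
    qed
  qed (use assms in auto)
  also have "\<dots> = Var P (\<lambda>\<gamma>. \<Sum>j\<in>?S. u (j / n) * measure \<gamma> (cell n j))"
    by (rule step_stat_moments(3)[OF P, symmetric]) auto
  finally show ?thesis .
qed

section \<open>Linear statistics of Lipschitz functions\<close>

lemma lin_stat_bound:
  assumes "\<gamma> \<in> configurations" "u \<in> borel_measurable borel" "W \<in> sets borel" "bounded W"
    and u: "\<And>x. \<bar>u x\<bar> \<le> c * indicat_real W x"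
  shows "integrable \<gamma> u" "\<bar>lin_stat u \<gamma>\<bar> \<le> c * measure \<gamma> W"
proof -
  note sets = sets_configuration[OF assms(1)]
  have W: "integrable \<gamma> (\<lambda>x. c * indicat_real W x)"
    using configuration_finite[OF assms(1,4,3)] assms(3) sets
    by (intro integrable_mult_right integrable_real_indicator) auto
  show int: "integrable \<gamma> u"
    by (rule Bochner_Integration.integrable_bound[OF W])
       (use assms(2) u measurable_cong_sets[OF sets refl]
         in \<open>auto intro!: AE_I2 order.trans[OF u abs_ge_self]\<close>)
  have "\<bar>lin_stat u \<gamma>\<bar> \<le> (\<integral>x. \<bar>u x\<bar> \<partial>\<gamma>)"
    unfolding lin_stat_def by (rule integral_abs_bound)
  also have "\<dots> \<le> (\<integral>x. c * indicat_real W x \<partial>\<gamma>)"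
    using int W u by (intro integral_mono) auto
  also have "\<dots> = c * measure \<gamma> W"
    using sets_eq_imp_space_eq[OF sets] by simp
  finally show "\<bar>lin_stat u \<gamma>\<bar> \<le> c * measure \<gamma> W" .
qed

text \<open>
  Every atom in the window is displaced by at most \<open>1/n\<close> when it is moved to the left end point of
  its cell.
\<close>
lemma lin_stat_step_approx:
  fixes u :: "real \<Rightarrow> real"
  assumes \<gamma>: "\<gamma> \<in> configurations" and n: "n > 0" and meas: "u \<in> borel_measurable borel"
    and lip: "\<And>x y. \<bar>u x - u y\<bar> \<le> \<Lambda> * \<bar>x - y\<bar>"
    and supp: "\<And>x. x \<notin> {-real R..<real R} \<Longrightarrow> u x = 0" and bdd: "\<And>x. \<bar>u x\<bar> \<le> c"
  shows "\<bar>lin_stat u \<gamma> - (\<Sum>j\<in>{- (int R * int n)..<int R * int n}. u (j / n) * measure \<gamma> (cell n j))\<bar>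
    \<le> \<Lambda> / n * measure \<gamma> {-real R..<real R}"
proof -
  let ?W = "{-real R..<real R}" and ?S = "{- (int R * int n)..<int R * int n}"
  note sets = sets_configuration[OF \<gamma>]
  define s where "s x = (\<Sum>j\<in>?S. u (j / n) * indicat_real (cell n j) x)" for x
  have W_iff: "x \<in> ?W \<longleftrightarrow> \<lfloor>x * n\<rfloor> \<in> ?S" for x
  proof -
    have "(\<Union>j\<in>?S. cell n j) = ?W"
      using Union_cells[OF n, of "- int R" "int R"] by simp
    moreover have "x \<in> (\<Union>j\<in>?S. cell n j) \<longleftrightarrow> \<lfloor>x * n\<rfloor> \<in> ?S"
      using n by (simp add: mem_cell_iff)
    ultimately show ?thesis
      by (simp only:)
  qed
  have s: "s x = (if x \<in> ?W then u (\<lfloor>x * n\<rfloor> / n) else 0)" for x :: real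
  proof -
    have "s x = (\<Sum>j\<in>?S. if j = \<lfloor>x * n\<rfloor> then u (j / n) else 0)"
      unfolding s_def using n by (intro sum.cong refl) (auto simp: indicator_def mem_cell_iff)
    thus ?thesis
      unfolding W_iff by simp
  qed
  have diff: "\<bar>u x - s x\<bar> \<le> \<Lambda> / n * indicat_real ?W x" for x :: real
  proof (cases "x \<in> ?W")
    case True
    have "\<bar>x - \<lfloor>x * n\<rfloor> / n\<bar> = \<bar>x * n - \<lfloor>x * n\<rfloor>\<bar> / n"
      using n by (simp add: field_simps abs_if)
    also have "\<dots> \<le> 1 / n"
      by (intro divide_right_mono) linarith+
    finally have "\<Lambda> * \<bar>x - \<lfloor>x * n\<rfloor> / n\<bar> \<le> \<Lambda> * (1 / n)"
      using lip[of 0 1] by (intro mult_left_mono) auto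
    thus ?thesis
      using True lip[of x "\<lfloor>x * n\<rfloor> / n"] by (simp add: s)
  qed (use supp s in auto)
  have "\<bar>u x\<bar> \<le> c * indicat_real ?W x" for x :: real
    using bdd[of x] supp[of x] by (simp add: indicator_def)
  hence int_u: "integrable \<gamma> u"
    by (intro lin_stat_bound(1)[OF \<gamma> meas, of ?W]) auto
  have int_cell: "integrable \<gamma> (indicat_real (cell n j))" for j
    using configuration_finite[OF \<gamma>, of "cell n j"] sets by (intro integrable_real_indicator) auto
  have "lin_stat (\<lambda>x. u x - s x) \<gamma> = lin_stat u \<gamma> - (\<integral>x. s x \<partial>\<gamma>)"
    unfolding lin_stat_def s_def
    by (intro Bochner_Integration.integral_diff int_u Bochner_Integration.integrable_sum
        integrable_mult_right int_cell)
  also have "(\<integral>x. s x \<partial>\<gamma>) = (\<Sum>j\<in>?S. u (j / n) * measure \<gamma> (cell n j))"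
    unfolding s_def using int_cell sets_eq_imp_space_eq[OF sets]
    by (subst Bochner_Integration.integral_sum) (auto intro!: integrable_mult_right)
  finally have stat: "lin_stat u \<gamma> - (\<Sum>j\<in>?S. u (j / n) * measure \<gamma> (cell n j))
      = lin_stat (\<lambda>x. u x - s x) \<gamma>"
    by simp
  have "(\<lambda>x. u x - s x) \<in> borel_measurable borel"
    unfolding s_def using meas by (intro borel_measurable_diff borel_measurable_sum
        borel_measurable_times borel_measurable_indicator) auto
  thus ?thesis
    unfolding stat by (rule lin_stat_bound(2)[OF \<gamma>]) (use diff in auto)
qed

text \<open>
  The step statistics converge pointwise and are dominated by a multiple of the number of points in
  the window, which is square integrable. So both measurability and the variance bound pass to the
  limit.
\<close>
lemma lin_stat_variance_lower_bound:
  assumes P: "sine2_law P" and r: "r \<ge> (1::nat)" and m: "0 \<le> m"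
    and meas: "u \<in> borel_measurable borel"
    and lip: "\<And>x y. \<bar>u x - u y\<bar> \<le> \<Lambda> * \<bar>x - y\<bar>"
    and bdd: "\<And>x. \<bar>u x\<bar> \<le> c"
    and u: "\<And>x. \<bar>x\<bar> \<le> r \<Longrightarrow> m \<le> u x" "\<And>x. \<bar>x\<bar> \<ge> 2 * r \<Longrightarrow> u x = 0"
  shows "lin_stat u \<in> borel_measurable P" "m\<^sup>2 / (64 * pi\<^sup>2) \<le> Var P (lin_stat u)"
proof -
  let ?W = "{-real (4 * r)..<real (4 * r)}"
  define Y where "Y n \<gamma> = (\<Sum>j\<in>{- (int (4 * r) * int (Suc n))..<int (4 * r) * int (Suc n)}.
      u (j / Suc n) * measure \<gamma> (cell (Suc n) j))" for n \<gamma>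
  have supp: "u x = 0" if "x \<notin> ?W" for x
    using that by (intro u(2)) auto
  have approx: "\<bar>lin_stat u \<gamma> - Y n \<gamma>\<bar> \<le> \<Lambda> / Suc n * measure \<gamma> ?W" if "\<gamma> \<in> configurations" for \<gamma> n
    unfolding Y_def by (rule lin_stat_step_approx[OF that _ meas lip supp bdd]) auto
  have lim: "(\<lambda>n. Y n \<gamma>) \<longlonglongrightarrow> lin_stat u \<gamma>" if \<gamma>: "\<gamma> \<in> space P" for \<gamma>
  proof -
    have "(\<lambda>n. inverse (real (Suc n)) * (\<Lambda> * measure \<gamma> ?W)) \<longlonglongrightarrow> 0 * (\<Lambda> * measure \<gamma> ?W)"
      by (intro tendsto_mult LIMSEQ_inverse_real_of_nat tendsto_const)
    hence lim0: "(\<lambda>n. \<Lambda> / Suc n * measure \<gamma> ?W) \<longlonglongrightarrow> 0"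
      by (simp add: divide_inverse mult_ac)
    have "(\<lambda>n. Y n \<gamma> - lin_stat u \<gamma>) \<longlonglongrightarrow> 0"
      by (rule Lim_null_comparison[OF _ lim0])
         (use approx \<gamma> in \<open>simp add: sine_space[OF P] abs_minus_commute\<close>)
    thus ?thesis
      by (simp add: LIM_zero_iff)
  qed
  have Y_meas: "Y n \<in> borel_measurable P" for n
    unfolding Y_def[abs_def] by (intro borel_measurable_integrable step_stat_moments P) auto
  show meas_stat: "lin_stat u \<in> borel_measurable P"
    by (rule borel_measurable_LIMSEQ_real[OF lim Y_meas])
  have "\<Lambda> \<ge> 0"
    using lip[of 0 1] by simp
  have bound: "\<bar>Y n \<gamma>\<bar> \<le> (c + \<Lambda>) * measure \<gamma> ?W" if "\<gamma> \<in> space P" for n \<gamma>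
  proof -
    have \<gamma>: "\<gamma> \<in> configurations"
      using that sine_space[OF P] by simp
    have "\<bar>lin_stat u \<gamma>\<bar> \<le> c * measure \<gamma> ?W"
      by (rule lin_stat_bound(2)[OF \<gamma> meas]) (use bdd supp in \<open>auto simp: indicator_def\<close>)
    moreover have "\<Lambda> / Suc n * measure \<gamma> ?W \<le> \<Lambda> * measure \<gamma> ?W"
      using \<open>\<Lambda> \<ge> 0\<close> by (intro mult_right_mono) (simp_all add: divide_le_eq mult_left_le mult_le_cancel_left1)
    ultimately show ?thesis
      using approx[OF \<gamma>, of n] by (simp add: distrib_right abs_le_iff)
  qed
  have "(\<lambda>n. Var P (Y n)) \<longlonglongrightarrow> Var P (lin_stat u)"
  proof (rule Var_tendsto[OF sine_prob_space[OF P] meas_stat Y_meas lim bound])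
    show "integrable P (\<lambda>\<gamma>. (c + \<Lambda>) * measure \<gamma> ?W)"
      "integrable P (\<lambda>\<gamma>. ((c + \<Lambda>) * measure \<gamma> ?W)\<^sup>2)"
      unfolding power_mult_distrib by (intro integrable_mult_right integrable_count P; simp)+
  qed
  moreover have "m\<^sup>2 / (64 * pi\<^sup>2) \<le> Var P (Y n)" for n
    unfolding Y_def[abs_def] using step_stat_variance_lower_bound[OF P _ r m u, of "Suc n"] by simp
  ultimately show "m\<^sup>2 / (64 * pi\<^sup>2) \<le> Var P (lin_stat u)"
    by (intro LIMSEQ_le_const) auto
qed

lemma scaled_sine_tendsto: "(\<lambda>n. real (Suc n) * sin (x / real (Suc n))) \<longlonglongrightarrow> x"
proof -
  have "((\<lambda>h. sin (x * h)) has_real_derivative x) (at 0)"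
    by (auto intro!: derivative_eq_intros)
  hence "((\<lambda>h. sin (x * h) / h) \<longlongrightarrow> x) (at 0)"
    by (simp add: has_field_derivative_iff)
  moreover have "filterlim (\<lambda>n. inverse (real (Suc n))) (at 0) sequentially"
    by (intro filterlim_atI LIMSEQ_inverse_real_of_nat) simp
  ultimately have "(\<lambda>n. sin (x * inverse (real (Suc n))) / inverse (real (Suc n))) \<longlonglongrightarrow> x"
    by (rule filterlim_compose)
  thus ?thesis
    by (simp add: field_simps)
qed

lemma Var_sine_stat_tendsto:
  assumes P: "sine2_law P" and meas: "lin_stat u \<in> borel_measurable P"
    and W: "W \<in> sets borel" "bounded W"
    and bound: "\<And>\<gamma>. \<gamma> \<in> configurations \<Longrightarrow> \<bar>lin_stat u \<gamma>\<bar> \<le> c * measure \<gamma> W"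
  shows "(\<lambda>n. Var P (sine_stat (real (Suc n)) (real (Suc n)) u)) \<longlonglongrightarrow> Var P (lin_stat u)"
proof (rule Var_tendsto[OF sine_prob_space[OF P] meas])
  show "sine_stat (real (Suc n)) (real (Suc n)) u \<in> borel_measurable P" for n
    unfolding sine_stat_def[abs_def] using meas by measurable
  show "(\<lambda>n. sine_stat (real (Suc n)) (real (Suc n)) u \<gamma>) \<longlonglongrightarrow> lin_stat u \<gamma>" for \<gamma>
    unfolding sine_stat_def by (rule scaled_sine_tendsto)
  show "\<bar>sine_stat (real (Suc n)) (real (Suc n)) u \<gamma>\<bar> \<le> c * measure \<gamma> W" if "\<gamma> \<in> space P" for n \<gamma>
  proof -
    have "\<bar>sine_stat (real (Suc n)) (real (Suc n)) u \<gamma>\<bar> \<le> real (Suc n) * \<bar>lin_stat u \<gamma> / real (Suc n)\<bar>"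
      unfolding sine_stat_def abs_mult by (simp only: abs_of_nat) (intro mult_left_mono abs_sin_x_le_abs_x, simp)
    also have "\<dots> = \<bar>lin_stat u \<gamma>\<bar>"
      by simp
    also have "\<dots> \<le> c * measure \<gamma> W"
      using that sine_space[OF P] by (intro bound) simp
    finally show ?thesis .
  qed
  show "integrable P (\<lambda>\<gamma>. c * measure \<gamma> W)" "integrable P (\<lambda>\<gamma>. (c * measure \<gamma> W)\<^sup>2)"
    unfolding power_mult_distrib using W by (intro integrable_mult_right integrable_count P; simp)+
qed

lemma energy_sine_stat_le:
  assumes P: "sine2_law P" and u: "u \<in> test_functions" and "L \<noteq> 0"
    and W: "W \<in> sets borel" "bounded W"
    and deriv: "\<And>x. \<bar>deriv u x\<bar> \<le> \<Lambda> * indicat_real W x"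
  shows "energy P (sine_stat L L u) (sine_stat L L u) \<le> \<Lambda>\<^sup>2 * measure lborel W / 2"
proof -
  have "(\<integral>\<gamma>. square_field2 (sine_stat L L u) (sine_stat L L u) \<gamma> \<partial>P) \<le> (\<integral>\<gamma>. \<Lambda>\<^sup>2 * measure \<gamma> W \<partial>P)"
  proof (rule integral_mono')
    show "integrable P (\<lambda>\<gamma>. \<Lambda>\<^sup>2 * measure \<gamma> W)"
      using W by (intro integrable_mult_right integrable_count P)
    fix \<gamma>
    assume "\<gamma> \<in> space P"
    hence \<gamma>: "\<gamma> \<in> configurations"
      using sine_space[OF P] by simp
    have "(deriv u x)\<^sup>2 \<le> \<Lambda>\<^sup>2 * indicat_real W x" for x
      using power_mono[OF deriv[of x] abs_ge_zero, of 2] by (cases "x \<in> W") simp_all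
    hence "\<bar>lin_stat (\<lambda>x. (deriv u x)\<^sup>2) \<gamma>\<bar> \<le> \<Lambda>\<^sup>2 * measure \<gamma> W"
      using test_function_deriv(3)[OF u] W by (intro lin_stat_bound(2)[OF \<gamma>]) auto
    moreover have "0 \<le> lin_stat (\<lambda>x. (deriv u x)\<^sup>2) \<gamma>"
      unfolding lin_stat_def by simp
    moreover have "(cos (lin_stat u \<gamma> / L))\<^sup>2 \<le> 1"
      by (simp add: abs_square_le_1)
    ultimately have "(cos (lin_stat u \<gamma> / L))\<^sup>2 * lin_stat (\<lambda>x. (deriv u x)\<^sup>2) \<gamma> \<le> 1 * (\<Lambda>\<^sup>2 * measure \<gamma> W)"
      by (intro mult_mono) auto
    thus "square_field2 (sine_stat L L u) (sine_stat L L u) \<gamma> \<le> \<Lambda>\<^sup>2 * measure \<gamma> W"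
      by (simp add: square_field2_sine_stat[OF u \<gamma> assms(3)])
  qed simp
  also have "\<dots> = \<Lambda>\<^sup>2 * measure lborel W"
    using integrable_count(2)[OF P W] by simp
  finally show ?thesis
    unfolding energy_def by simp
qed

lemma test_function_lipschitz:
  assumes "u \<in> test_functions" "\<And>x. \<bar>deriv u x\<bar> \<le> \<Lambda>"
  shows "\<bar>u x - u y\<bar> \<le> \<Lambda> * \<bar>x - y\<bar>"
proof -
  obtain z where "u x - u y = deriv u z * (x - y)"
    using real_mvt_segment[OF test_function_deriv(1)[OF assms(1)], of y x] by blast
  thus ?thesis
    using assms(2)[of z] by (simp add: abs_mult mult_right_mono)
qed

section \<open>Absence of a spectral gap\<close>

theorem mainTheorem1:
  fixes \<mu> :: "real measure measure"
    and \<E> :: "(real measure \<Rightarrow> real) \<Rightarrow> (real measure \<Rightarrow> real) \<Rightarrow> real"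
    and F :: "(real measure \<Rightarrow> real) set"
  assumes "sine2_law \<mu>"
    and "closed_extension \<mu> \<E> F"
  shows "(INF u \<in> {u \<in> F. Var \<mu> u \<noteq> 0}. ereal (\<E> u u / Var \<mu> u)) = 0"
proof (rule antisym)
  interpret prob_space \<mu>
    using assms(1) by (rule sine_prob_space)
  have Q: "nonneg_symmetric_form \<mu> \<E> F" and cyl: "cylinder_functions \<subseteq> F"
    and energy: "\<And>U. U \<in> cylinder_functions \<Longrightarrow> \<E> U U = energy \<mu> U U"
    using assms(2) by (simp_all add: closed_extension_def closed_form_def)
  have sub: "L2_subspace \<mu> F"
    using Q unfolding nonneg_symmetric_form_def by (elim conjE)
  have nonneg: "\<forall>u\<in>F. 0 \<le> \<E> u u"
    using Q unfolding nonneg_symmetric_form_def by (elim conjE)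
  have L2: "F \<subseteq> L2 \<mu>"
    using sub unfolding L2_subspace_def by (rule conjunct1)
  show "0 \<le> (INF u \<in> {u \<in> F. Var \<mu> u \<noteq> 0}. ereal (\<E> u u / Var \<mu> u))"
  proof (rule INF_greatest)
    fix u
    assume u: "u \<in> {u \<in> F. Var \<mu> u \<noteq> 0}"
    hence sq: "u \<in> borel_measurable \<mu>" "integrable \<mu> (\<lambda>x. (u x)\<^sup>2)"
      using L2 by (auto simp: L2_def)
    have "0 \<le> Var \<mu> u"
      by (rule Var_nonneg[OF prob_space_axioms square_integrable_imp_integrable[OF sq] sq(2)])
    thus "0 \<le> ereal (\<E> u u / Var \<mu> u)"
      using nonneg u by simp
  qed
  show "(INF u \<in> {u \<in> F. Var \<mu> u \<noteq> 0}. ereal (\<E> u u / Var \<mu> u)) \<le> 0"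
  proof (rule ereal_le_epsilon2)
    fix e :: real
    assume e: "0 < e"
    obtain D where D: "0 \<le> D" "\<And>r x. r > 0 \<Longrightarrow> \<bar>deriv (bump r) x\<bar> \<le> D / r"
      "\<And>r x. r > 0 \<Longrightarrow> \<bar>x\<bar> \<ge> 2 * r \<Longrightarrow> deriv (bump r) x = 0"
      using bump_deriv_bound by blast
    define v where "v = (exp (- (4 / 3)))\<^sup>2 / (64 * pi\<^sup>2)"
    have v: "0 < v"
      by (simp add: v_def)
    have "0 < e * (v / 2)"
      using e v by simp
    \<comment> \<open>The energy will be at most \<open>2D\<^sup>2/r\<close> and the variance at least \<open>v/2\<close>.\<close>
    then obtain r0 :: nat where r0: "2 * D\<^sup>2 < real r0 * (e * (v / 2))"
      using reals_Archimedean3 by blast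
    define r where "r = Suc r0"
    have r: "r \<ge> 1" "real r > 0" and rD: "2 * D\<^sup>2 / r \<le> e * (v / 2)"
    proof -
      have "real r0 * (e * (v / 2)) \<le> real r * (e * (v / 2))"
        using e v by (intro mult_right_mono) (auto simp: r_def)
      thus "2 * D\<^sup>2 / r \<le> e * (v / 2)"
        using r0 by (simp add: r_def divide_le_eq mult.commute)
    qed (auto simp: r_def)
    let ?u = "bump (real r)" and ?W = "{-2 * real r..<2 * real r}"
    have test: "?u \<in> test_functions"
      by (rule bump_test_function[OF r(2)])
    have "?u \<in> borel_measurable borel"
      by (rule test_function_deriv(2)[OF test])
    note lower = lin_stat_variance_lower_bound[OF assms(1) r(1) exp_ge_zero this
        test_function_lipschitz[OF test D(2)[OF r(2)]] abs_bump_le]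
    have meas: "lin_stat ?u \<in> borel_measurable \<mu>"
      by (rule lower(1)) (use bump_ge[OF r(2)] bump_eq_0[OF r(2)] in auto)
    have "v \<le> Var \<mu> (lin_stat ?u)"
      unfolding v_def by (rule lower(2)) (use bump_ge[OF r(2)] bump_eq_0[OF r(2)] in auto)
    have stat_bound: "\<bar>lin_stat ?u \<gamma>\<bar> \<le> 1 * measure \<gamma> ?W" if "\<gamma> \<in> configurations" for \<gamma>
    proof (rule lin_stat_bound(2)[OF that \<open>?u \<in> borel_measurable borel\<close>])
      show "\<bar>?u x\<bar> \<le> 1 * indicat_real ?W x" for x :: real
        using abs_bump_le[of "real r" x] bump_eq_0[OF r(2), of x]
        by (cases "\<bar>x\<bar> \<ge> 2 * real r") (auto simp: indicator_def)
    qed auto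
    have "(\<lambda>n. Var \<mu> (sine_stat (real (Suc n)) (real (Suc n)) ?u)) \<longlonglongrightarrow> Var \<mu> (lin_stat ?u)"
      by (rule Var_sine_stat_tendsto[OF assms(1) meas _ _ stat_bound]) auto
    moreover have "v / 2 < Var \<mu> (lin_stat ?u)"
      using \<open>v \<le> _\<close> v by linarith
    ultimately have "eventually (\<lambda>n. v / 2 < Var \<mu> (sine_stat (real (Suc n)) (real (Suc n)) ?u)) sequentially"
      by (rule order_tendstoD)
    then obtain n where n: "v / 2 < Var \<mu> (sine_stat (real (Suc n)) (real (Suc n)) ?u)"
      by (auto simp: eventually_sequentially)
    define U where "U = sine_stat (real (Suc n)) (real (Suc n)) ?u"
    have U: "U \<in> cylinder_functions"
      unfolding U_def cylinder_functions_def using sine_stat_rep[OF test] by blast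
    have "\<E> U U \<le> (D / r)\<^sup>2 * measure lborel ?W / 2"
      unfolding energy[OF U] unfolding U_def
    proof (rule energy_sine_stat_le[OF assms(1) test])
      show "\<bar>deriv ?u x\<bar> \<le> D / r * indicat_real ?W x" for x :: real
        using D(2)[OF r(2), of x] D(3)[OF r(2), of x]
        by (cases "\<bar>x\<bar> \<ge> 2 * real r") (auto simp: indicator_def)
    qed auto
    also have "\<dots> = 2 * D\<^sup>2 / r"
      using r by (simp add: power2_eq_square)
    also have "\<dots> \<le> e * (v / 2)"
      by (rule rD)
    also have "\<dots> \<le> e * Var \<mu> U"
      using n e by (simp add: U_def)
    finally have "\<E> U U / Var \<mu> U \<le> e"
      using n v by (simp add: U_def divide_le_eq)
    moreover have "U \<in> {u \<in> F. Var \<mu> u \<noteq> 0}"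
      using U cyl n v unfolding U_def by auto
    ultimately show "(INF u \<in> {u \<in> F. Var \<mu> u \<noteq> 0}. ereal (\<E> u u / Var \<mu> u)) \<le> 0 + ereal e"
      by (intro INF_lower2[of U]) auto
  qed
qed

end
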